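(* Let $\mathcal{E}$ be a topos satisfying NS, WDQO and DSO, with its associated homotopy theory $p:1_{\mathcal{E}}\Rightarrow\Pi_0=\mathcal{I}\Pi$. The following statements are equivalent: (1) $\mathcal{E}$ is sufficiently cohesive. (2) The identity map of the subobject classifier $\Omega$ is $p$-homotopic to a constant map; i.e. $\Omega$ is contractible. (3) There is a bipointed connected object. (4) Any nonempty $\neg\neg$-sheaf in $\mathcal{E}$ is connected.
   Context: A point of $X$ is an arrow $1\to X$. An object of a topos is decidable if its diagonal is a complemented subobject; $\mathcal{I}:\mathrm{Dec}(\mathcal{E})\to\mathcal{E}$ is the inclusion of the full subcategory of decidable objects. NS: every non-initial object has a point. WDQO: for every object $X$ there is a minimal decidable object, $p_X:X\to\Pi(X)$ with $\Pi(X)$ decidable, such that every arrow $X\to1+1$ factors uniquely through $p_X$. DSO: for every object $X$ there is a unique decidable subobject $\gamma_X:\Gamma X\rightarrowtail X$ containing all the points of $X$. For a topos satisfying NS and WDQO, $\Pi$ is a finite-product-preserving functor left adjoint to $\mathcal{I}$ with unit $p$; $p:1_{\mathcal{E}}\Rightarrow\Pi_0=\mathcal{I}\Pi$ is called the associated homotopy theory. The name $\ulcorner f\urcorner:1\to Y^X$ of $f:X\to Y$ is the transpose of $f\circ\pi_X:1\times X\to Y$. Arrows $f,g:X\to Y$ are $p$-homotopic if $p_{Y^X}\circ\ulcorner f\urcorner=p_{Y^X}\circ\ulcorner g\urcorner$. An object $A$ is connected if $\Pi(A)=1$; it is ($p$-)contractible if there is a point $a:1\to A$ with $1_A$ $p$-homotopic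 to $a!:A\to1\to A$. An object is bipointed if it has two different points. An object $A$ is Lawvere contractible if $A^X$ is connected for every $X\in\mathcal{E}$; $\mathcal{E}$ is sufficiently cohesive if every object is a subobject of a Lawvere contractible object. Nonempty means non-initial. A $\neg\neg$-sheaf is a sheaf for the double-negation local operator on $\mathcal{E}$.
   Formalization: The topos is assumed nondegenerate (the terminal object is not initial); in the degenerate topos NS, WDQO, DSO and statements (1), (2), (4) hold, but (3) fails because no object has two different points. *)

theory Defs
  imports Main
begin

section \<open>Categories\<close>

record ('o, 'a) category =
  Obj :: "'o set"
  Arr :: "'a set"
  Dom :: "'a \<Rightarrow> 'o"
  Cod :: "'a \<Rightarrow> 'o"
  Idn :: "'o \<Rightarrow> 'a"
  Comp :: "'a \<Rightarrow> 'a \<Rightarrow> 'a"  (infixl \<open>\<cdot>\<index>\<close> 70)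

definition Hom :: "('o, 'a, 'm) category_scheme \<Rightarrow> 'o \<Rightarrow> 'o \<Rightarrow> 'a set" where
  "Hom C X Y = {f \<in> Arr C. Dom C f = X \<and> Cod C f = Y}"

locale category =
  fixes C :: "('o, 'a, 'm) category_scheme" (structure)
  assumes Dom_Obj: "f \<in> Arr C \<Longrightarrow> Dom C f \<in> Obj C"
    and Cod_Obj: "f \<in> Arr C \<Longrightarrow> Cod C f \<in> Obj C"
    and Idn_Hom: "X \<in> Obj C \<Longrightarrow> Idn C X \<in> Hom C X X"
    and Comp_Hom: "f \<in> Hom C X Y \<Longrightarrow> g \<in> Hom C Y Z \<Longrightarrow> g \<cdot> f \<in> Hom C X Z"
    and Comp_Idn_left: "f \<in> Hom C X Y \<Longrightarrow> Idn C Y \<cdot> f = f"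
    and Comp_Idn_right: "f \<in> Hom C X Y \<Longrightarrow> f \<cdot> Idn C X = f"
    and Comp_assoc:
      "f \<in> Hom C W X \<Longrightarrow> g \<in> Hom C X Y \<Longrightarrow> h \<in> Hom C Y Z \<Longrightarrow> (h \<cdot> g) \<cdot> f = h \<cdot> (g \<cdot> f)"

definition isomorphic :: "('o, 'a, 'm) category_scheme \<Rightarrow> 'o \<Rightarrow> 'o \<Rightarrow> bool" where
  "isomorphic C X Y \<longleftrightarrow>
     (\<exists>f \<in> Hom C X Y. \<exists>g \<in> Hom C Y X. g \<cdot>\<^bsub>C\<^esub> f = Idn C X \<and> f \<cdot>\<^bsub>C\<^esub> g = Idn C Y)"

definition terminal :: "('o, 'a, 'm) category_scheme \<Rightarrow> 'o \<Rightarrow> bool" where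
  "terminal C T \<longleftrightarrow> T \<in> Obj C \<and> (\<forall>X \<in> Obj C. \<exists>!f. f \<in> Hom C X T)"

definition initial :: "('o, 'a, 'm) category_scheme \<Rightarrow> 'o \<Rightarrow> bool" where
  "initial C Z \<longleftrightarrow> Z \<in> Obj C \<and> (\<forall>X \<in> Obj C. \<exists>!f. f \<in> Hom C Z X)"

definition product :: "('o, 'a, 'm) category_scheme \<Rightarrow> 'o \<Rightarrow> 'o \<Rightarrow> 'o \<Rightarrow> 'a \<Rightarrow> 'a \<Rightarrow> bool" where
  "product C X Y P p q \<longleftrightarrow>
     P \<in> Obj C \<and> p \<in> Hom C P X \<and> q \<in> Hom C P Y \<and>
     (\<forall>Z \<in> Obj C. \<forall>f \<in> Hom C Z X. \<forall>g \<in> Hom C Z Y.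
        \<exists>!h. h \<in> Hom C Z P \<and> p \<cdot>\<^bsub>C\<^esub> h = f \<and> q \<cdot>\<^bsub>C\<^esub> h = g)"

definition coproduct :: "('o, 'a, 'm) category_scheme \<Rightarrow> 'o \<Rightarrow> 'o \<Rightarrow> 'o \<Rightarrow> 'a \<Rightarrow> 'a \<Rightarrow> bool" where
  "coproduct C X Y S i j \<longleftrightarrow>
     S \<in> Obj C \<and> i \<in> Hom C X S \<and> j \<in> Hom C Y S \<and>
     (\<forall>Z \<in> Obj C. \<forall>f \<in> Hom C X Z. \<forall>g \<in> Hom C Y Z.
        \<exists>!h. h \<in> Hom C S Z \<and> h \<cdot>\<^bsub>C\<^esub> i = f \<and> h \<cdot>\<^bsub>C\<^esub> j = g)"

definition equalizer :: "('o, 'a, 'm) category_scheme \<Rightarrow> 'a \<Rightarrow> 'a \<Rightarrow> 'a \<Rightarrow> bool" where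
  "equalizer C f g e \<longleftrightarrow>
     e \<in> Hom C (Dom C e) (Dom C f) \<and> f \<cdot>\<^bsub>C\<^esub> e = g \<cdot>\<^bsub>C\<^esub> e \<and>
     (\<forall>Z \<in> Obj C. \<forall>h \<in> Hom C Z (Dom C f). f \<cdot>\<^bsub>C\<^esub> h = g \<cdot>\<^bsub>C\<^esub> h \<longrightarrow>
        (\<exists>!k. k \<in> Hom C Z (Dom C e) \<and> e \<cdot>\<^bsub>C\<^esub> k = h))"

text \<open>\<open>pullback C p q f g\<close>: the commutative square \<open>f \<cdot> p = g \<cdot> q\<close> is a pullback.\<close>

definition pullback :: "('o, 'a, 'm) category_scheme \<Rightarrow> 'a \<Rightarrow> 'a \<Rightarrow> 'a \<Rightarrow> 'a \<Rightarrow> bool" where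
  "pullback C p q f g \<longleftrightarrow>
     f \<in> Arr C \<and> g \<in> Arr C \<and> Cod C f = Cod C g \<and>
     p \<in> Hom C (Dom C p) (Dom C f) \<and> q \<in> Hom C (Dom C p) (Dom C g) \<and>
     f \<cdot>\<^bsub>C\<^esub> p = g \<cdot>\<^bsub>C\<^esub> q \<and>
     (\<forall>Z \<in> Obj C. \<forall>u \<in> Hom C Z (Dom C f). \<forall>v \<in> Hom C Z (Dom C g).
        f \<cdot>\<^bsub>C\<^esub> u = g \<cdot>\<^bsub>C\<^esub> v \<longrightarrow>
        (\<exists>!k. k \<in> Hom C Z (Dom C p) \<and> p \<cdot>\<^bsub>C\<^esub> k = u \<and> q \<cdot>\<^bsub>C\<^esub> k = v))"

definition monic :: "('o, 'a, 'm) category_scheme \<Rightarrow> 'a \<Rightarrow> bool" where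
  "monic C m \<longleftrightarrow>
     m \<in> Arr C \<and>
     (\<forall>Z \<in> Obj C. \<forall>f \<in> Hom C Z (Dom C m). \<forall>g \<in> Hom C Z (Dom C m).
        m \<cdot>\<^bsub>C\<^esub> f = m \<cdot>\<^bsub>C\<^esub> g \<longrightarrow> f = g)"

text \<open>
  Subobjects of \<open>X\<close> are represented by monomorphisms into \<open>X\<close>, preordered by factorization;
  equality of subobjects is mutual factorization.
\<close>

definition subobject :: "('o, 'a, 'm) category_scheme \<Rightarrow> 'o \<Rightarrow> 'a \<Rightarrow> bool" where
  "subobject C X m \<longleftrightarrow> monic C m \<and> Cod C m = X"

definition factors_through :: "('o, 'a, 'm) category_scheme \<Rightarrow> 'a \<Rightarrow> 'a \<Rightarrow> bool" where
  "factors_through C f m \<longleftrightarrow> (\<exists>h \<in> Hom C (Dom C f) (Dom C m). m \<cdot>\<^bsub>C\<^esub> h = f)"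

text \<open>Complements are taken in the lattice of subobjects of \<open>X\<close>: meet bottom, join top.\<close>

definition complemented :: "('o, 'a, 'm) category_scheme \<Rightarrow> 'o \<Rightarrow> 'a \<Rightarrow> bool" where
  "complemented C X m \<longleftrightarrow>
     subobject C X m \<and>
     (\<exists>n. subobject C X n \<and>
        (\<forall>k. subobject C X k \<and> factors_through C k m \<and> factors_through C k n \<longrightarrow>
           (\<forall>l. subobject C X l \<longrightarrow> factors_through C k l)) \<and>
        (\<forall>k. subobject C X k \<and> factors_through C m k \<and> factors_through C n k \<longrightarrow>
           (\<forall>l. subobject C X l \<longrightarrow> factors_through C l k)))"


section \<open>Elementary toposes\<close>

text \<open>
  \<open>Exp E Y X\<close> is $Y^X$, with evaluation \<open>Ev E Y X\<close> from \<open>Prod E (Exp E Y X) X\<close> to \<open>Y\<close>.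
\<close>

record ('o, 'a) topos = "('o, 'a) category" +
  One :: 'o
  Prod :: "'o \<Rightarrow> 'o \<Rightarrow> 'o"
  Pr1 :: "'o \<Rightarrow> 'o \<Rightarrow> 'a"
  Pr2 :: "'o \<Rightarrow> 'o \<Rightarrow> 'a"
  Exp :: "'o \<Rightarrow> 'o \<Rightarrow> 'o"
  Ev :: "'o \<Rightarrow> 'o \<Rightarrow> 'a"
  Omega :: 'o
  Tru :: 'a

definition bang :: "('o, 'a, 'm) topos_scheme \<Rightarrow> 'o \<Rightarrow> 'a" where
  "bang E X = (THE f. f \<in> Hom E X (One E))"

definition pair :: "('o, 'a, 'm) topos_scheme \<Rightarrow> 'a \<Rightarrow> 'a \<Rightarrow> 'a" where
  "pair E f g = (THE h. h \<in> Hom E (Dom E f) (Prod E (Cod E f) (Cod E g)) \<and>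
     Pr1 E (Cod E f) (Cod E g) \<cdot>\<^bsub>E\<^esub> h = f \<and> Pr2 E (Cod E f) (Cod E g) \<cdot>\<^bsub>E\<^esub> h = g)"

definition cross :: "('o, 'a, 'm) topos_scheme \<Rightarrow> 'a \<Rightarrow> 'a \<Rightarrow> 'a" where
  "cross E f g =
     pair E (f \<cdot>\<^bsub>E\<^esub> Pr1 E (Dom E f) (Dom E g)) (g \<cdot>\<^bsub>E\<^esub> Pr2 E (Dom E f) (Dom E g))"

locale topos = category E for E :: "('o, 'a, 'm) topos_scheme" (structure) +
  assumes terminal_One: "terminal E (One E)"
    and product_Prod:
      "X \<in> Obj E \<Longrightarrow> Y \<in> Obj E \<Longrightarrow> product E X Y (Prod E X Y) (Pr1 E X Y) (Pr2 E X Y)"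
    and ex_equalizer: "f \<in> Hom E X Y \<Longrightarrow> g \<in> Hom E X Y \<Longrightarrow> \<exists>e. equalizer E f g e"
    and Exp_Obj: "X \<in> Obj E \<Longrightarrow> Y \<in> Obj E \<Longrightarrow> Exp E Y X \<in> Obj E"
    and Ev_Hom: "X \<in> Obj E \<Longrightarrow> Y \<in> Obj E \<Longrightarrow> Ev E Y X \<in> Hom E (Prod E (Exp E Y X) X) Y"
    and ex1_transpose:
      "X \<in> Obj E \<Longrightarrow> Y \<in> Obj E \<Longrightarrow> Z \<in> Obj E \<Longrightarrow> h \<in> Hom E (Prod E Z X) Y \<Longrightarrow>
        \<exists>!k. k \<in> Hom E Z (Exp E Y X) \<and> Ev E Y X \<cdot> cross E k (Idn E X) = h"
    and Omega_Obj: "Omega E \<in> Obj E"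
    and Tru_Hom: "Tru E \<in> Hom E (One E) (Omega E)"
    and ex1_classifier:
      "monic E m \<Longrightarrow>
        \<exists>!\<chi>. \<chi> \<in> Hom E (Cod E m) (Omega E) \<and> pullback E m (bang E (Dom E m)) \<chi> (Tru E)"

definition transpose :: "('o, 'a, 'm) topos_scheme \<Rightarrow> 'o \<Rightarrow> 'o \<Rightarrow> 'o \<Rightarrow> 'a \<Rightarrow> 'a" where
  "transpose E Z X Y h =
     (THE k. k \<in> Hom E Z (Exp E Y X) \<and> Ev E Y X \<cdot>\<^bsub>E\<^esub> cross E k (Idn E X) = h)"

definition name_of :: "('o, 'a, 'm) topos_scheme \<Rightarrow> 'a \<Rightarrow> 'a" where
  "name_of E f =
     transpose E (One E) (Dom E f) (Cod E f) (f \<cdot>\<^bsub>E\<^esub> Pr2 E (One E) (Dom E f))"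

definition classifier :: "('o, 'a, 'm) topos_scheme \<Rightarrow> 'a \<Rightarrow> 'a" where
  "classifier E m = (THE \<chi>. \<chi> \<in> Hom E (Cod E m) (Omega E) \<and>
     pullback E m (bang E (Dom E m)) \<chi> (Tru E))"

definition point :: "('o, 'a, 'm) topos_scheme \<Rightarrow> 'o \<Rightarrow> 'a \<Rightarrow> bool" where
  "point E X x \<longleftrightarrow> x \<in> Hom E (One E) X"

definition bipointed :: "('o, 'a, 'm) topos_scheme \<Rightarrow> 'o \<Rightarrow> bool" where
  "bipointed E X \<longleftrightarrow> X \<in> Obj E \<and> (\<exists>x y. point E X x \<and> point E X y \<and> x \<noteq> y)"

definition decidable :: "('o, 'a, 'm) topos_scheme \<Rightarrow> 'o \<Rightarrow> bool" where
  "decidable E X \<longleftrightarrow>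
     X \<in> Obj E \<and> complemented E (Prod E X X) (pair E (Idn E X) (Idn E X))"


section \<open>Double-negation sheaves\<close>

text \<open>
  Initial objects exist in every elementary topos, and the arrow defined next does not depend
  on the one chosen.
\<close>

definition Fls :: "('o, 'a, 'm) topos_scheme \<Rightarrow> 'a" where
  "Fls E = classifier E (bang E (SOME Z. initial E Z))"

definition neg :: "('o, 'a, 'm) topos_scheme \<Rightarrow> 'a" where
  "neg E = classifier E (Fls E)"

definition dneg :: "('o, 'a, 'm) topos_scheme \<Rightarrow> 'a" where
  "dneg E = neg E \<cdot>\<^bsub>E\<^esub> neg E"

definition dense :: "('o, 'a, 'm) topos_scheme \<Rightarrow> 'a \<Rightarrow> 'a \<Rightarrow> bool" where
  "dense E j m \<longleftrightarrow>
     monic E m \<and> j \<cdot>\<^bsub>E\<^esub> classifier E m = Tru E \<cdot>\<^bsub>E\<^esub> bang E (Cod E m)"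

definition sheaf :: "('o, 'a, 'm) topos_scheme \<Rightarrow> 'a \<Rightarrow> 'o \<Rightarrow> bool" where
  "sheaf E j F \<longleftrightarrow>
     F \<in> Obj E \<and>
     (\<forall>m. dense E j m \<longrightarrow>
        (\<forall>f \<in> Hom E (Dom E m) F. \<exists>!g. g \<in> Hom E (Cod E m) F \<and> g \<cdot>\<^bsub>E\<^esub> m = f))"


section \<open>The axioms NS, WDQO and DSO\<close>

definition NS :: "('o, 'a, 'm) topos_scheme \<Rightarrow> bool" where
  "NS E \<longleftrightarrow> (\<forall>X \<in> Obj E. \<not> initial E X \<longrightarrow> (\<exists>x. point E X x))"

text \<open>
  The coproduct \<open>1 + 1\<close> exists in every elementary topos and is unique up to isomorphism, so
  quantifying over all its presentations is the same as fixing one.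
\<close>

definition minimal_decidable ::
    "('o, 'a, 'm) topos_scheme \<Rightarrow> 'o \<Rightarrow> 'o \<Rightarrow> 'a \<Rightarrow> bool" where
  "minimal_decidable E X D q \<longleftrightarrow>
     decidable E D \<and> q \<in> Hom E X D \<and>
     (\<forall>T i j. coproduct E (One E) (One E) T i j \<longrightarrow>
        (\<forall>f \<in> Hom E X T. \<exists>!g. g \<in> Hom E D T \<and> g \<cdot>\<^bsub>E\<^esub> q = f))"

definition WDQO :: "('o, 'a, 'm) topos_scheme \<Rightarrow> bool" where
  "WDQO E \<longleftrightarrow> (\<forall>X \<in> Obj E. \<exists>D q. minimal_decidable E X D q)"

definition decidable_subobject_of_points ::
    "('o, 'a, 'm) topos_scheme \<Rightarrow> 'o \<Rightarrow> 'a \<Rightarrow> bool" where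
  "decidable_subobject_of_points E X m \<longleftrightarrow>
     subobject E X m \<and> decidable E (Dom E m) \<and>
     (\<forall>x. point E X x \<longrightarrow> factors_through E x m)"

definition DSO :: "('o, 'a, 'm) topos_scheme \<Rightarrow> bool" where
  "DSO E \<longleftrightarrow> (\<forall>X \<in> Obj E. \<exists>\<gamma>. decidable_subobject_of_points E X \<gamma> \<and>
     (\<forall>m. decidable_subobject_of_points E X m \<longrightarrow>
        factors_through E m \<gamma> \<and> factors_through E \<gamma> m))"


section \<open>The associated homotopy theory\<close>

text \<open>
  A choice of minimal decidable objects determines the functor $\Pi$: its value at an arrow
  \<open>f\<close> from \<open>X\<close> to \<open>Y\<close> is the unique \<open>h\<close> with \<open>h \<cdot> p X = p Y \<cdot> f\<close>. Only its values on objects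
  and the components of the unit are used below.
\<close>

definition homotopy_theory ::
    "('o, 'a, 'm) topos_scheme \<Rightarrow> ('o \<Rightarrow> 'o) \<Rightarrow> ('o \<Rightarrow> 'a) \<Rightarrow> bool" where
  "homotopy_theory E \<Pi> p \<longleftrightarrow> (\<forall>X \<in> Obj E. minimal_decidable E X (\<Pi> X) (p X))"

definition homotopic :: "('o, 'a, 'm) topos_scheme \<Rightarrow> ('o \<Rightarrow> 'a) \<Rightarrow> 'a \<Rightarrow> 'a \<Rightarrow> bool" where
  "homotopic E p f g \<longleftrightarrow>
     f \<in> Arr E \<and> g \<in> Hom E (Dom E f) (Cod E f) \<and>
     p (Exp E (Cod E f) (Dom E f)) \<cdot>\<^bsub>E\<^esub> name_of E f =
     p (Exp E (Cod E f) (Dom E f)) \<cdot>\<^bsub>E\<^esub> name_of E g"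

definition contractible :: "('o, 'a, 'm) topos_scheme \<Rightarrow> ('o \<Rightarrow> 'a) \<Rightarrow> 'o \<Rightarrow> bool" where
  "contractible E p A \<longleftrightarrow>
     A \<in> Obj E \<and> (\<exists>a. point E A a \<and> homotopic E p (Idn E A) (a \<cdot>\<^bsub>E\<^esub> bang E A))"

definition is_connected :: "('o, 'a, 'm) topos_scheme \<Rightarrow> ('o \<Rightarrow> 'o) \<Rightarrow> 'o \<Rightarrow> bool" where
  "is_connected E \<Pi> A \<longleftrightarrow> A \<in> Obj E \<and> isomorphic E (\<Pi> A) (One E)"

definition Lawvere_contractible ::
    "('o, 'a, 'm) topos_scheme \<Rightarrow> ('o \<Rightarrow> 'o) \<Rightarrow> 'o \<Rightarrow> bool" where
  "Lawvere_contractible E \<Pi> A \<longleftrightarrow>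
     A \<in> Obj E \<and> (\<forall>X \<in> Obj E. is_connected E \<Pi> (Exp E A X))"

definition sufficiently_cohesive ::
    "('o, 'a, 'm) topos_scheme \<Rightarrow> ('o \<Rightarrow> 'o) \<Rightarrow> bool" where
  "sufficiently_cohesive E \<Pi> \<longleftrightarrow>
     (\<forall>X \<in> Obj E. \<exists>A m. Lawvere_contractible E \<Pi> A \<and> subobject E A m \<and> Dom E m = X)"

end

theory Submission
  imports Defs
begin

text \<open>
  All four conditions are equivalent to: no arrow from \<open>Omega E\<close> to \<open>1 + 1\<close> separates true from
  false. For points, being identified by \<open>p\<close> means not being separated by arrows into \<open>1 + 1\<close>,
  and an object is connected when it has a point and no two of its points are separated; arrows
  preserve non-separation. By NS the only points of \<open>Omega E\<close> are true and false.

  The characteristic arrow of one of two distinct points of a connected object sends them to true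
  and false, and evaluating a contraction of \<open>Omega E\<close> at its points does the same. Conversely
  conjunction is a homotopy, parametrized by \<open>Omega E\<close>, from the identity (at true) to a constant
  (at false); applied to power objects, into which every object embeds by singletons, it shows that
  they are Lawvere contractible. Finally \<open>1 + 1\<close> is the decidable subobject of points of
  \<open>Omega E\<close> and is dense in it for double negation, so any two points of a sheaf are the values at
  true and false of an arrow from \<open>Omega E\<close>, while the regular truth values form a bipointed sheaf.
\<close>

section \<open>Finite limits\<close>

text \<open>The axioms supply limits, exponentials and \<open>Omega E\<close> but no colimits, while
  decidability, negation and WDQO speak of initial objects, unions and 1 + 1. Building these shapes
  most of the development. Unions are replaced by \<open>covers\<close>: every subobject containing
  both parts is everything. Such statements must survive pulling back, and for this the right
  adjoint of pulling back a subobject is constructed. The coproduct 1 + 1 comes from DSO: NS leaves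
  \<open>Omega E\<close> only two points, and uniqueness in DSO forces these to cover the decidable
  subobject they lie in.

  Arguments run on generalized elements: an arrow w satisfies a predicate \<chi> when \<chi> \<cdot>
  w is constantly true, and belongs to a subobject when it factors through it. Negation then has its
  forcing clause, in which "never" means only at initial stages, and NS turns such clauses into
  statements about points.

  The link between \<open>p\<close> and separation is that a decidable object has an equality test
  with values in 1 + 1: pulled back along \<open>p X\<close>, it is one of the arrows that could
  separate points.\<close>

context category
begin

lemma Hom_iff [simp]: "f \<in> Hom C X Y \<longleftrightarrow> f \<in> Arr C \<and> Dom C f = X \<and> Cod C f = Y"
  by (simp add: Hom_def)

lemma Dom_in_Obj [simp]: "f \<in> Arr C \<Longrightarrow> Dom C f \<in> Obj C"
  by (rule Dom_Obj)

lemma Cod_in_Obj [simp]: "f \<in> Arr C \<Longrightarrow> Cod C f \<in> Obj C"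
  by (rule Cod_Obj)

lemma Idn_in_Arr [simp]:
  assumes "X \<in> Obj C"
  shows "Idn C X \<in> Arr C" "Dom C (Idn C X) = X" "Cod C (Idn C X) = X"
  using Idn_Hom[OF assms] by auto

lemma comp_in_Arr [simp]:
  assumes "f \<in> Arr C" "g \<in> Arr C" "Cod C f = Dom C g"
  shows "g \<cdot> f \<in> Arr C" "Dom C (g \<cdot> f) = Dom C f" "Cod C (g \<cdot> f) = Cod C g"
  using Comp_Hom[of f "Dom C f" "Cod C f" g "Cod C g"] assms by auto

lemma comp_Idn [simp]:
  assumes "f \<in> Arr C"
  shows "Cod C f = X \<Longrightarrow> Idn C X \<cdot> f = f" "Dom C f = X \<Longrightarrow> f \<cdot> Idn C X = f"
  using Comp_Idn_left[of f "Dom C f" "Cod C f"] Comp_Idn_right[of f "Dom C f" "Cod C f"] assms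
  by auto

lemma comp_assoc [simp]:
  assumes "f \<in> Arr C" "g \<in> Arr C" "h \<in> Arr C" "Cod C f = Dom C g" "Cod C g = Dom C h"
  shows "(h \<cdot> g) \<cdot> f = h \<cdot> (g \<cdot> f)"
  using Comp_assoc[of f "Dom C f" "Cod C f" g "Cod C g" h "Cod C h"] assms by auto

text \<open>The simp rule \<open>comp_assoc\<close> moves parentheses to the right and so hides a
  known composite g \<cdot> f inside g \<cdot> (f \<cdot> w); this rule recovers it.\<close>

lemma comp_reassoc:
  assumes "g \<cdot> f = k" "f \<in> Arr C" "g \<in> Arr C" "w \<in> Arr C" "Cod C f = Dom C g" "Cod C w = Dom C f"
  shows "g \<cdot> (f \<cdot> w) = k \<cdot> w"
  using assms comp_assoc by metis

lemma monicI:
  assumes "m \<in> Arr C"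
    and "\<And>f g. f \<in> Arr C \<Longrightarrow> g \<in> Arr C \<Longrightarrow> Dom C f = Dom C g \<Longrightarrow> Cod C f = Dom C m \<Longrightarrow>
      Cod C g = Dom C m \<Longrightarrow> m \<cdot> f = m \<cdot> g \<Longrightarrow> f = g"
  shows "monic C m"
  using assms unfolding monic_def by simp

lemma monicD:
  assumes "monic C m" "m \<cdot> f = m \<cdot> g" "f \<in> Arr C" "g \<in> Arr C" "Dom C f = Dom C g"
    "Cod C f = Dom C m" "Cod C g = Dom C m"
  shows "f = g"
  using assms unfolding monic_def by (metis Dom_in_Obj Hom_iff)

lemma monic_Arr [simp]: "monic C m \<Longrightarrow> m \<in> Arr C"
  by (simp add: monic_def)

lemma monic_comp:
  assumes "monic C m" "monic C n" "Cod C n = Dom C m"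
  shows "monic C (m \<cdot> n)"
proof (rule monicI)
  fix f g
  assume *: "f \<in> Arr C" "g \<in> Arr C" "Dom C f = Dom C g" "Cod C f = Dom C (m \<cdot> n)"
    "Cod C g = Dom C (m \<cdot> n)" "(m \<cdot> n) \<cdot> f = (m \<cdot> n) \<cdot> g"
  then have "m \<cdot> (n \<cdot> f) = m \<cdot> (n \<cdot> g)"
    using assms by simp
  then have "n \<cdot> f = n \<cdot> g"
    by (rule monicD[OF assms(1)]) (use * assms in simp_all)
  then show "f = g"
    by (rule monicD[OF assms(2)]) (use * assms in simp_all)
qed (use assms in simp)

lemma monic_Idn [simp]: "X \<in> Obj C \<Longrightarrow> monic C (Idn C X)"
  by (rule monicI) auto

lemma factorsI:
  assumes "m \<cdot> h = f" "h \<in> Arr C" "Dom C h = Dom C f" "Cod C h = Dom C m"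
  shows "factors_through C f m"
  using assms unfolding factors_through_def by auto

lemma factorsE:
  assumes "factors_through C f m"
  obtains h where "m \<cdot> h = f" "h \<in> Arr C" "Dom C h = Dom C f" "Cod C h = Dom C m"
  using assms unfolding factors_through_def by auto

lemma factors_comp:
  assumes "factors_through C f m" "m \<in> Arr C" "w \<in> Arr C" "Cod C w = Dom C f"
  shows "factors_through C (f \<cdot> w) m"
proof -
  obtain h where "m \<cdot> h = f" "h \<in> Arr C" "Dom C h = Dom C f" "Cod C h = Dom C m"
    using assms(1) by (rule factorsE)
  then show ?thesis
    using assms by (intro factorsI[of m "h \<cdot> w"]) auto
qed

lemma factors_trans:
  assumes "factors_through C f m" "factors_through C m k" "k \<in> Arr C"
  shows "factors_through C f k"
proof -
  obtain h where h: "m \<cdot> h = f" "h \<in> Arr C" "Dom C h = Dom C f" "Cod C h = Dom C m"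
    using assms(1) by (rule factorsE)
  obtain l where l: "k \<cdot> l = m" "l \<in> Arr C" "Dom C l = Dom C m" "Cod C l = Dom C k"
    using assms(2) by (rule factorsE)
  then show ?thesis
    using assms h by (intro factorsI[of k "l \<cdot> h"]) (auto simp flip: comp_assoc)
qed

end

section \<open>The terminal object and equalizers\<close>

context topos
begin

lemma One_Obj [simp]: "One E \<in> Obj E"
  using terminal_One by (simp add: terminal_def)

lemma Arr_One_unique:
  assumes "f \<in> Arr E" "g \<in> Arr E" "Dom E f = Dom E g" "Cod E f = One E" "Cod E g = One E"
  shows "f = g"
  using terminal_One assms unfolding terminal_def by (metis Dom_in_Obj Hom_iff)

lemma bang_in_Arr [simp]:
  assumes "X \<in> Obj E"
  shows "bang E X \<in> Arr E" "Dom E (bang E X) = X" "Cod E (bang E X) = One E"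
proof -
  have "\<exists>!f. f \<in> Hom E X (One E)"
    using terminal_One assms unfolding terminal_def by blast
  then have "bang E X \<in> Hom E X (One E)"
    unfolding bang_def by (rule theI')
  then show "bang E X \<in> Arr E" "Dom E (bang E X) = X" "Cod E (bang E X) = One E"
    by auto
qed

lemma bang_comp [simp]: "f \<in> Arr E \<Longrightarrow> Cod E f = X \<Longrightarrow> bang E X \<cdot> f = bang E (Dom E f)"
  by (rule Arr_One_unique) auto

lemma bang_One [simp]: "bang E (One E) = Idn E (One E)"
  by (rule Arr_One_unique) auto

lemma monic_point: "x \<in> Arr E \<Longrightarrow> Dom E x = One E \<Longrightarrow> monic E x"
  by (rule monicI) (auto intro: Arr_One_unique)

text \<open>The universal property in the form used throughout: an equalizer is the subobject whose
  generalized elements are the solutions of the equation.\<close>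

lemma equalizer_ex:
  assumes "f \<in> Arr E" "g \<in> Arr E" "Dom E f = Dom E g" "Cod E f = Cod E g"
  obtains e where "monic E e" "Cod E e = Dom E f"
    "\<And>w. w \<in> Arr E \<Longrightarrow> Cod E w = Dom E f \<Longrightarrow> factors_through E w e \<longleftrightarrow> f \<cdot> w = g \<cdot> w"
proof -
  obtain e where e: "equalizer E f g e"
    using ex_equalizer[of f "Dom E f" "Cod E f" g] assms by auto
  then have e1: "e \<in> Arr E" "Cod E e = Dom E f" "f \<cdot> e = g \<cdot> e"
    unfolding equalizer_def by auto
  have univ: "\<exists>!k. k \<in> Hom E (Dom E h) (Dom E e) \<and> e \<cdot> k = h"
    if "h \<in> Arr E" "Cod E h = Dom E f" "f \<cdot> h = g \<cdot> h" for h
  proof -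
    have "\<forall>Z\<in>Obj E. \<forall>h\<in>Hom E Z (Dom E f). f \<cdot> h = g \<cdot> h \<longrightarrow>
        (\<exists>!k. k \<in> Hom E Z (Dom E e) \<and> e \<cdot> k = h)"
      using e unfolding equalizer_def by blast
    moreover have "Dom E h \<in> Obj E" "h \<in> Hom E (Dom E h) (Dom E f)"
      using that by simp_all
    ultimately show ?thesis
      using that(3) by blast
  qed
  show thesis
  proof
    show "monic E e"
    proof (rule monicI[OF e1(1)])
      fix u v
      assume *: "u \<in> Arr E" "v \<in> Arr E" "Dom E u = Dom E v" "Cod E u = Dom E e"
        "Cod E v = Dom E e" "e \<cdot> u = e \<cdot> v"
      have "f \<cdot> (e \<cdot> u) = g \<cdot> (e \<cdot> u)"
        using comp_reassoc[OF e1(3), of u] e1(1,2) * assms by simp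
      then have "\<exists>!k. k \<in> Hom E (Dom E (e \<cdot> u)) (Dom E e) \<and> e \<cdot> k = e \<cdot> u"
        by (intro univ) (use e1(1,2) * in simp_all)
      moreover have "u \<in> Hom E (Dom E (e \<cdot> u)) (Dom E e) \<and> e \<cdot> u = e \<cdot> u"
        "v \<in> Hom E (Dom E (e \<cdot> u)) (Dom E e) \<and> e \<cdot> v = e \<cdot> u"
        using e1(1) * by simp_all
      ultimately show "u = v"
        by blast
    qed
    show "Cod E e = Dom E f"
      by (fact e1)
    show "factors_through E w e \<longleftrightarrow> f \<cdot> w = g \<cdot> w" if w: "w \<in> Arr E" "Cod E w = Dom E f" for w
    proof
      assume "factors_through E w e"
      then obtain h where h: "e \<cdot> h = w" "h \<in> Arr E" "Dom E h = Dom E w" "Cod E h = Dom E e"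
        by (rule factorsE)
      have "(f \<cdot> e) \<cdot> h = (g \<cdot> e) \<cdot> h"
        by (simp only: e1(3))
      then have "f \<cdot> (e \<cdot> h) = g \<cdot> (e \<cdot> h)"
        using e1(1,2) h(2-4) assms by simp
      then show "f \<cdot> w = g \<cdot> w"
        by (simp add: h(1))
    next
      assume "f \<cdot> w = g \<cdot> w"
      then show "factors_through E w e"
        using univ[OF w] unfolding factors_through_def by blast
    qed
  qed
qed

section \<open>Binary products and pairing\<close>

lemma Prod_Obj [simp]: "X \<in> Obj E \<Longrightarrow> Y \<in> Obj E \<Longrightarrow> Prod E X Y \<in> Obj E"
  using product_Prod by (simp add: product_def)

lemma Pr_in_Arr [simp]:
  assumes "X \<in> Obj E" "Y \<in> Obj E"
  shows "Pr1 E X Y \<in> Arr E" "Dom E (Pr1 E X Y) = Prod E X Y" "Cod E (Pr1 E X Y) = X"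
    "Pr2 E X Y \<in> Arr E" "Dom E (Pr2 E X Y) = Prod E X Y" "Cod E (Pr2 E X Y) = Y"
  using product_Prod[OF assms] by (auto simp: product_def)

lemma pair_in_Arr [simp]:
  assumes "f \<in> Arr E" "g \<in> Arr E" "Dom E f = Dom E g"
  shows "pair E f g \<in> Arr E" "Dom E (pair E f g) = Dom E g"
    "Cod E (pair E f g) = Prod E (Cod E f) (Cod E g)"
    "Cod E f = X \<Longrightarrow> Cod E g = Y \<Longrightarrow> Pr1 E X Y \<cdot> pair E f g = f"
    "Cod E f = X \<Longrightarrow> Cod E g = Y \<Longrightarrow> Pr2 E X Y \<cdot> pair E f g = g"
proof -
  have "\<exists>!h. h \<in> Hom E (Dom E f) (Prod E (Cod E f) (Cod E g)) \<and>
     Pr1 E (Cod E f) (Cod E g) \<cdot> h = f \<and> Pr2 E (Cod E f) (Cod E g) \<cdot> h = g"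
    using product_Prod[of "Cod E f" "Cod E g"] assms unfolding product_def by auto
  from theI'[OF this, folded pair_def] assms(3)
  show "pair E f g \<in> Arr E" "Dom E (pair E f g) = Dom E g"
    "Cod E (pair E f g) = Prod E (Cod E f) (Cod E g)"
    "Cod E f = X \<Longrightarrow> Cod E g = Y \<Longrightarrow> Pr1 E X Y \<cdot> pair E f g = f"
    "Cod E f = X \<Longrightarrow> Cod E g = Y \<Longrightarrow> Pr2 E X Y \<cdot> pair E f g = g"
    by auto
qed

lemma Prod_ext:
  assumes "h \<in> Arr E" "k \<in> Arr E" "Dom E h = Dom E k" "Cod E h = Prod E X Y" "Cod E k = Prod E X Y"
    "X \<in> Obj E" "Y \<in> Obj E"
    "Pr1 E X Y \<cdot> h = Pr1 E X Y \<cdot> k" "Pr2 E X Y \<cdot> h = Pr2 E X Y \<cdot> k"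
  shows "h = k"
proof -
  have "\<forall>Z\<in>Obj E. \<forall>f\<in>Hom E Z X. \<forall>g\<in>Hom E Z Y.
        \<exists>!h. h \<in> Hom E Z (Prod E X Y) \<and> Pr1 E X Y \<cdot> h = f \<and> Pr2 E X Y \<cdot> h = g"
    using product_Prod[OF assms(6,7)] unfolding product_def by blast
  moreover have "Dom E h \<in> Obj E" "Pr1 E X Y \<cdot> h \<in> Hom E (Dom E h) X" "Pr2 E X Y \<cdot> h \<in> Hom E (Dom E h) Y"
    using assms by auto
  ultimately have "\<exists>!k. k \<in> Hom E (Dom E h) (Prod E X Y) \<and> Pr1 E X Y \<cdot> k = Pr1 E X Y \<cdot> h \<and> Pr2 E X Y \<cdot> k = Pr2 E X Y \<cdot> h"
    by blast
  then show ?thesis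
    using assms by (metis Hom_iff)
qed

lemma pair_comp [simp]:
  assumes "f \<in> Arr E" "g \<in> Arr E" "Dom E f = Dom E g" "w \<in> Arr E" "Cod E w = Dom E g"
  shows "pair E f g \<cdot> w = pair E (f \<cdot> w) (g \<cdot> w)"
proof (rule Prod_ext[where X = "Cod E f" and Y = "Cod E g"])
  show "Pr1 E (Cod E f) (Cod E g) \<cdot> (pair E f g \<cdot> w) = Pr1 E (Cod E f) (Cod E g) \<cdot> pair E (f \<cdot> w) (g \<cdot> w)"
    using assms by (simp flip: comp_assoc)
  show "Pr2 E (Cod E f) (Cod E g) \<cdot> (pair E f g \<cdot> w) = Pr2 E (Cod E f) (Cod E g) \<cdot> pair E (f \<cdot> w) (g \<cdot> w)"
    using assms by (simp flip: comp_assoc)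
qed (use assms in auto)

lemma pair_eta:
  assumes "h \<in> Arr E" "Cod E h = Prod E X Y" "X \<in> Obj E" "Y \<in> Obj E"
  shows "pair E (Pr1 E X Y \<cdot> h) (Pr2 E X Y \<cdot> h) = h"
  by (rule Prod_ext[where X = X and Y = Y]) (use assms in auto)

lemma pair_inject:
  assumes "pair E f g = pair E f' g'" "f \<in> Arr E" "g \<in> Arr E" "f' \<in> Arr E" "g' \<in> Arr E"
    "Dom E f = Dom E g" "Dom E f' = Dom E g'" "Cod E f = Cod E f'" "Cod E g = Cod E g'"
  shows "f = f'" "g = g'"
proof -
  have "Pr1 E (Cod E f) (Cod E g) \<cdot> pair E f g = f" "Pr1 E (Cod E f) (Cod E g) \<cdot> pair E f' g' = f'"
    "Pr2 E (Cod E f) (Cod E g) \<cdot> pair E f g = g" "Pr2 E (Cod E f) (Cod E g) \<cdot> pair E f' g' = g'"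
    using assms(2-) by (intro pair_in_Arr(4,5); simp)+
  then show "f = f'" "g = g'"
    using assms(1) by simp_all
qed

lemma cross_in_Arr [simp]:
  assumes "f \<in> Arr E" "g \<in> Arr E"
  shows "cross E f g \<in> Arr E" "Dom E (cross E f g) = Prod E (Dom E f) (Dom E g)"
    "Cod E (cross E f g) = Prod E (Cod E f) (Cod E g)"
  using assms by (simp_all add: cross_def)

lemma cross_pair [simp]:
  assumes "f \<in> Arr E" "g \<in> Arr E" "u \<in> Arr E" "v \<in> Arr E" "Dom E u = Dom E v"
    "Cod E u = Dom E f" "Cod E v = Dom E g"
  shows "cross E f g \<cdot> pair E u v = pair E (f \<cdot> u) (g \<cdot> v)"
  using assms by (simp add: cross_def)

section \<open>Subobjects and truth values\<close>

lemma Omega_in_Obj [simp]: "Omega E \<in> Obj E"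
  by (rule Omega_Obj)

lemma Tru_in_Arr [simp]: "Tru E \<in> Arr E" "Dom E (Tru E) = One E" "Cod E (Tru E) = Omega E"
  using Tru_Hom by auto

text \<open>The predicate that always holds. An equation
  \<open>\<chi> \<cdot> w = tru (Dom E w)\<close> is to be read as: the stage \<open>Dom E w\<close>
  forces \<chi> of the generalized element w.\<close>

definition tru :: "'o \<Rightarrow> 'a" where
  "tru X = Tru E \<cdot> bang E X"

lemma tru_in_Arr [simp]:
  assumes "X \<in> Obj E"
  shows "tru X \<in> Arr E" "Dom E (tru X) = X" "Cod E (tru X) = Omega E"
  using assms by (simp_all add: tru_def)

lemma tru_comp [simp]: "w \<in> Arr E \<Longrightarrow> Cod E w = X \<Longrightarrow> tru X \<cdot> w = tru (Dom E w)"
  by (auto simp: tru_def)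

lemma tru_One: "tru (One E) = Tru E"
  by (simp add: tru_def)

lemma classifier_props:
  assumes "monic E m"
  shows "classifier E m \<in> Arr E \<and> Dom E (classifier E m) = Cod E m \<and>
    Cod E (classifier E m) = Omega E \<and>
    pullback E m (bang E (Dom E m)) (classifier E m) (Tru E)"
  using theI'[OF ex1_classifier[OF assms]] unfolding classifier_def by auto

lemma classifier_in_Arr [simp]:
  assumes "monic E m"
  shows "classifier E m \<in> Arr E" "Dom E (classifier E m) = Cod E m" "Cod E (classifier E m) = Omega E"
  using classifier_props[OF assms] by auto

text \<open>Arrows into 1 are unique, so the second leg of the classifying pullback carries no
  information and the pullback property reduces to membership.\<close>

lemma classifier_iff:
  assumes "monic E m" "w \<in> Arr E" "Cod E w = Cod E m"
  shows "classifier E m \<cdot> w = tru (Dom E w) \<longleftrightarrow> factors_through E w m"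
proof
  have pb: "pullback E m (bang E (Dom E m)) (classifier E m) (Tru E)"
    using classifier_props[OF assms(1)] by blast
  have sq: "classifier E m \<cdot> m = tru (Dom E m)"
    using pb unfolding pullback_def tru_def by blast
  have univ: "\<forall>Z\<in>Obj E. \<forall>u\<in>Hom E Z (Cod E m). \<forall>v\<in>Hom E Z (One E).
       classifier E m \<cdot> u = Tru E \<cdot> v \<longrightarrow>
       (\<exists>!k. k \<in> Hom E Z (Dom E m) \<and> m \<cdot> k = u \<and> bang E (Dom E m) \<cdot> k = v)"
    using pb assms(1) unfolding pullback_def by simp
  {
    assume *: "classifier E m \<cdot> w = tru (Dom E w)"
    have "\<exists>!k. k \<in> Hom E (Dom E w) (Dom E m) \<and> m \<cdot> k = w \<and> bang E (Dom E m) \<cdot> k = bang E (Dom E w)"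
      using univ[rule_format, of "Dom E w" w "bang E (Dom E w)"] * assms by (simp add: tru_def)
    then show "factors_through E w m"
      unfolding factors_through_def by blast
  next
    assume "factors_through E w m"
    then obtain h where h: "m \<cdot> h = w" "h \<in> Arr E" "Dom E h = Dom E w" "Cod E h = Dom E m"
      by (rule factorsE)
    have "classifier E m \<cdot> (m \<cdot> h) = tru (Dom E w)"
      by (rule trans[OF comp_reassoc[OF sq]]) (use h(2-4) assms in auto)
    then show "classifier E m \<cdot> w = tru (Dom E w)"
      by (simp add: h(1))
  }
qed

lemma classifier_unique:
  assumes "monic E m" "\<chi> \<in> Arr E" "Dom E \<chi> = Cod E m" "Cod E \<chi> = Omega E"
    "\<And>w. w \<in> Arr E \<Longrightarrow> Cod E w = Cod E m \<Longrightarrow> \<chi> \<cdot> w = tru (Dom E w) \<longleftrightarrow> factors_through E w m"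
  shows "\<chi> = classifier E m"
proof -
  have "pullback E m (bang E (Dom E m)) \<chi> (Tru E)"
    unfolding pullback_def
  proof (intro conjI ballI impI)
    have "factors_through E m m"
      by (rule factorsI[of m "Idn E (Dom E m)"]) (use assms in auto)
    then show "\<chi> \<cdot> m = Tru E \<cdot> bang E (Dom E m)"
      using assms(5)[of m] assms(1) by (simp add: tru_def)
    fix Z u v
    assume *: "Z \<in> Obj E" "u \<in> Hom E Z (Dom E \<chi>)" "v \<in> Hom E Z (Dom E (Tru E))" "\<chi> \<cdot> u = Tru E \<cdot> v"
    have v: "v = bang E Z"
      by (rule Arr_One_unique) (use * in auto)
    then have "factors_through E u m"
      using assms(5)[of u] * assms by (simp add: tru_def)
    then obtain h where h: "m \<cdot> h = u" "h \<in> Arr E" "Dom E h = Dom E u" "Cod E h = Dom E m"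
      by (rule factorsE)
    show "\<exists>!k. k \<in> Hom E Z (Dom E m) \<and> m \<cdot> k = u \<and> bang E (Dom E m) \<cdot> k = v"
    proof (rule ex1I[of _ h])
      show "h \<in> Hom E Z (Dom E m) \<and> m \<cdot> h = u \<and> bang E (Dom E m) \<cdot> h = v"
        using h * v by simp
      show "k = h" if "k \<in> Hom E Z (Dom E m) \<and> m \<cdot> k = u \<and> bang E (Dom E m) \<cdot> k = v" for k
        by (rule monicD[OF assms(1)]) (use that h * in auto)
    qed
  qed (use assms in auto)
  then show ?thesis
    using ex1_classifier[OF assms(1)] classifier_props[OF assms(1)] assms by auto
qed

text \<open>Comprehension, obtained as the equalizer of \<chi> with the predicate that always holds;
  general pullbacks are thereby avoided.\<close>

lemma subobject_of_predicate:
  assumes "\<chi> \<in> Arr E" "Cod E \<chi> = Omega E"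
  obtains m where "monic E m" "Cod E m = Dom E \<chi>"
    "\<And>w. w \<in> Arr E \<Longrightarrow> Cod E w = Dom E \<chi> \<Longrightarrow> factors_through E w m \<longleftrightarrow> \<chi> \<cdot> w = tru (Dom E w)"
proof -
  obtain m where m: "monic E m" "Cod E m = Dom E \<chi>"
    "\<And>w. w \<in> Arr E \<Longrightarrow> Cod E w = Dom E \<chi> \<Longrightarrow> factors_through E w m \<longleftrightarrow> \<chi> \<cdot> w = tru (Dom E \<chi>) \<cdot> w"
    using equalizer_ex[of \<chi> "tru (Dom E \<chi>)"] assms by auto
  with that show thesis
    by simp
qed

text \<open>Predicates with the same generalized elements classify the same subobject. This
  extensionality lets identities between truth values be proved by forcing.\<close>

lemma Omega_ext:
  assumes "\<chi> \<in> Arr E" "\<psi> \<in> Arr E" "Dom E \<chi> = Dom E \<psi>" "Cod E \<chi> = Omega E" "Cod E \<psi> = Omega E"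
    and "\<And>w. w \<in> Arr E \<Longrightarrow> Cod E w = Dom E \<psi> \<Longrightarrow> \<chi> \<cdot> w = tru (Dom E w) \<longleftrightarrow> \<psi> \<cdot> w = tru (Dom E w)"
  shows "\<chi> = \<psi>"
proof -
  obtain m where m: "monic E m" "Cod E m = Dom E \<chi>"
    "\<And>w. w \<in> Arr E \<Longrightarrow> Cod E w = Dom E \<chi> \<Longrightarrow> factors_through E w m \<longleftrightarrow> \<chi> \<cdot> w = tru (Dom E w)"
    using subobject_of_predicate[OF assms(1,4)] by blast
  have "\<chi> = classifier E m"
    by (rule classifier_unique) (use m assms in auto)
  moreover have "\<psi> = classifier E m"
    by (rule classifier_unique) (use m assms in auto)
  ultimately show ?thesis
    by simp
qed

section \<open>Exponentials\<close>

lemma Exp_in_Obj [simp]: "X \<in> Obj E \<Longrightarrow> Y \<in> Obj E \<Longrightarrow> Exp E Y X \<in> Obj E"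
  by (rule Exp_Obj)

lemma Ev_in_Arr [simp]:
  assumes "X \<in> Obj E" "Y \<in> Obj E"
  shows "Ev E Y X \<in> Arr E" "Dom E (Ev E Y X) = Prod E (Exp E Y X) X" "Cod E (Ev E Y X) = Y"
  using Ev_Hom[OF assms] by auto

lemma transpose_in_Arr [simp]:
  assumes "h \<in> Arr E" "Dom E h = Prod E Z X" "Cod E h = Y" "X \<in> Obj E" "Z \<in> Obj E"
  shows "transpose E Z X Y h \<in> Arr E" "Dom E (transpose E Z X Y h) = Z"
    "Cod E (transpose E Z X Y h) = Exp E Y X"
    "Ev E Y X \<cdot> cross E (transpose E Z X Y h) (Idn E X) = h"
proof -
  have "Y \<in> Obj E"
    using assms by auto
  then have "\<exists>!k. k \<in> Hom E Z (Exp E Y X) \<and> Ev E Y X \<cdot> cross E k (Idn E X) = h"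
    using assms by (intro ex1_transpose) auto
  from theI'[OF this, folded transpose_def]
  show "transpose E Z X Y h \<in> Arr E" "Dom E (transpose E Z X Y h) = Z"
    "Cod E (transpose E Z X Y h) = Exp E Y X"
    "Ev E Y X \<cdot> cross E (transpose E Z X Y h) (Idn E X) = h"
    by auto
qed

lemma transpose_beta:
  assumes "h \<in> Arr E" "Dom E h = Prod E Z X" "Cod E h = Y" "X \<in> Obj E" "Z \<in> Obj E"
    and "u \<in> Arr E" "x \<in> Arr E" "Dom E u = Dom E x" "Cod E u = Z" "Cod E x = X"
  shows "Ev E Y X \<cdot> pair E (transpose E Z X Y h \<cdot> u) x = h \<cdot> pair E u x"
proof -
  have Y: "Y \<in> Obj E"
    using assms by auto
  have "Ev E Y X \<cdot> (cross E (transpose E Z X Y h) (Idn E X) \<cdot> pair E u x) = h \<cdot> pair E u x"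
    by (rule comp_reassoc) (use assms Y in auto)
  then show ?thesis
    using assms Y by simp
qed

lemma Exp_ext:
  assumes "k \<in> Arr E" "l \<in> Arr E" "Dom E k = Dom E l" "Cod E k = Exp E Y X" "Cod E l = Exp E Y X"
    "X \<in> Obj E" "Y \<in> Obj E"
    and *: "\<And>w x. w \<in> Arr E \<Longrightarrow> x \<in> Arr E \<Longrightarrow> Dom E w = Dom E x \<Longrightarrow> Cod E w = Dom E l \<Longrightarrow> Cod E x = X \<Longrightarrow>
      Ev E Y X \<cdot> pair E (k \<cdot> w) x = Ev E Y X \<cdot> pair E (l \<cdot> w) x"
  shows "k = l"
proof -
  have Z: "Dom E l \<in> Obj E"
    using assms by simp
  have "\<exists>!k. k \<in> Hom E (Dom E l) (Exp E Y X) \<and> Ev E Y X \<cdot> cross E k (Idn E X) = Ev E Y X \<cdot> cross E l (Idn E X)"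
    using assms by (intro ex1_transpose) auto
  moreover have "Ev E Y X \<cdot> cross E k (Idn E X) = Ev E Y X \<cdot> cross E l (Idn E X)"
    using *[of "Pr1 E (Dom E l) X" "Pr2 E (Dom E l) X"] assms by (simp add: cross_def)
  ultimately show ?thesis
    using assms by auto
qed

text \<open>
  The right adjoint of pulling back along \<open>f\<close>: it consists of the \<open>x\<close> for which the set of all
  \<open>y\<close> over \<open>x\<close> equals the set of those \<open>y\<close> over \<open>x\<close> that lie in \<open>k\<close>, an equalizer of two arrows
  into \<open>Exp E (Omega E) Y\<close>.
\<close>

lemma universal_image:
  assumes "f \<in> Arr E" "monic E k" "Cod E k = Dom E f"
  obtains q where "monic E q" "Cod E q = Cod E f"
    "\<And>h. h \<in> Arr E \<Longrightarrow> Cod E h = Cod E f \<Longrightarrow> factors_through E h q \<longleftrightarrow>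
      (\<forall>w y. w \<in> Arr E \<and> y \<in> Arr E \<and> Dom E w = Dom E y \<and> Cod E w = Dom E h \<and> Cod E y = Dom E f \<and>
        f \<cdot> y = h \<cdot> w \<longrightarrow> factors_through E y k)"
proof -
  define Y X where "Y = Dom E f" and "X = Cod E f"
  define a b where "a = pair E f (Idn E Y)" and "b = pair E (f \<cdot> k) k"
  have ty: "Y \<in> Obj E" "X \<in> Obj E" "Cod E k = Y" "f \<in> Arr E" "k \<in> Arr E" "Dom E f = Y" "Cod E f = X"
    using assms by (auto simp: Y_def X_def)
  have ta: "a \<in> Arr E" "Dom E a = Y" "Cod E a = Prod E X Y"
    and tb: "b \<in> Arr E" "Dom E b = Dom E k" "Cod E b = Prod E X Y"
    using ty by (auto simp: a_def b_def)
  have ma: "monic E a"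
  proof (rule monicI)
    fix u v
    assume *: "u \<in> Arr E" "v \<in> Arr E" "Dom E u = Dom E v" "Cod E u = Dom E a" "Cod E v = Dom E a" "a \<cdot> u = a \<cdot> v"
    then have "pair E (f \<cdot> u) u = pair E (f \<cdot> v) v"
      using ty ta by (simp add: a_def)
    then show "u = v"
      by (rule pair_inject) (use * ty ta in auto)
  qed (fact ta)
  have mb: "monic E b"
  proof (rule monicI)
    fix u v
    assume *: "u \<in> Arr E" "v \<in> Arr E" "Dom E u = Dom E v" "Cod E u = Dom E b" "Cod E v = Dom E b" "b \<cdot> u = b \<cdot> v"
    then have "pair E (f \<cdot> (k \<cdot> u)) (k \<cdot> u) = pair E (f \<cdot> (k \<cdot> v)) (k \<cdot> v)"
      using ty tb by (simp add: b_def)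
    then have "k \<cdot> u = k \<cdot> v"
      by (rule pair_inject) (use * ty tb in auto)
    then show "u = v"
      by (rule monicD[OF assms(2)]) (use * ty tb in auto)
  qed (fact tb)
  define \<alpha> \<beta> where "\<alpha> = transpose E X Y (Omega E) (classifier E a)"
    and "\<beta> = transpose E X Y (Omega E) (classifier E b)"
  have t\<alpha>: "\<alpha> \<in> Arr E" "Dom E \<alpha> = X" "Cod E \<alpha> = Exp E (Omega E) Y"
    and t\<beta>: "\<beta> \<in> Arr E" "Dom E \<beta> = X" "Cod E \<beta> = Exp E (Omega E) Y"
    using ty ma mb ta tb by (auto simp: \<alpha>_def \<beta>_def)
  have fa: "factors_through E (pair E x y) a \<longleftrightarrow> f \<cdot> y = x"
    if "x \<in> Arr E" "y \<in> Arr E" "Dom E x = Dom E y" "Cod E x = X" "Cod E y = Y" for x y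
  proof
    assume "factors_through E (pair E x y) a"
    then obtain h where h: "a \<cdot> h = pair E x y" "h \<in> Arr E" "Dom E h = Dom E (pair E x y)" "Cod E h = Dom E a"
      by (rule factorsE)
    then have *: "pair E (f \<cdot> h) h = pair E x y"
      using ty ta by (simp add: a_def)
    have "f \<cdot> h = x"
      by (rule pair_inject(1)[OF *]) (use h ty ta that in auto)
    moreover have "h = y"
      by (rule pair_inject(2)[OF *]) (use h ty ta that in auto)
    ultimately show "f \<cdot> y = x"
      by simp
  next
    assume "f \<cdot> y = x"
    then show "factors_through E (pair E x y) a"
      using that ty ta by (intro factorsI[of a y]) (auto simp: a_def)
  qed
  have fb: "factors_through E (pair E x y) b \<longleftrightarrow> f \<cdot> y = x \<and> factors_through E y k"
    if "x \<in> Arr E" "y \<in> Arr E" "Dom E x = Dom E y" "Cod E x = X" "Cod E y = Y" for x y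
  proof
    assume "factors_through E (pair E x y) b"
    then obtain h where h: "b \<cdot> h = pair E x y" "h \<in> Arr E" "Dom E h = Dom E (pair E x y)" "Cod E h = Dom E b"
      by (rule factorsE)
    then have *: "pair E (f \<cdot> (k \<cdot> h)) (k \<cdot> h) = pair E x y"
      using ty tb by (simp add: b_def)
    have "f \<cdot> (k \<cdot> h) = x"
      by (rule pair_inject(1)[OF *]) (use h ty tb that in auto)
    moreover have "k \<cdot> h = y"
      by (rule pair_inject(2)[OF *]) (use h ty tb that in auto)
    ultimately show "f \<cdot> y = x \<and> factors_through E y k"
      using h tb that by (auto intro: factorsI)
  next
    assume *: "f \<cdot> y = x \<and> factors_through E y k"
    then obtain h where h: "k \<cdot> h = y" "h \<in> Arr E" "Dom E h = Dom E y" "Cod E h = Dom E k"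
      by (auto elim: factorsE)
    then show "factors_through E (pair E x y) b"
      using that ty tb * by (intro factorsI[of b h]) (auto simp: b_def)
  qed
  obtain q where q: "monic E q" "Cod E q = X"
    "\<And>w. w \<in> Arr E \<Longrightarrow> Cod E w = X \<Longrightarrow> factors_through E w q \<longleftrightarrow> \<alpha> \<cdot> w = \<beta> \<cdot> w"
    using equalizer_ex[of \<alpha> \<beta>] t\<alpha> t\<beta> by auto
  have "factors_through E h q \<longleftrightarrow>
      (\<forall>w y. w \<in> Arr E \<and> y \<in> Arr E \<and> Dom E w = Dom E y \<and> Cod E w = Dom E h \<and> Cod E y = Dom E f \<and>
        f \<cdot> y = h \<cdot> w \<longrightarrow> factors_through E y k)" (is "_ \<longleftrightarrow> ?R")
    if h: "h \<in> Arr E" "Cod E h = Cod E f" for h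
  proof
    assume "factors_through E h q"
    then have eq: "\<alpha> \<cdot> h = \<beta> \<cdot> h"
      using q(3)[of h] h ty by simp
    show ?R
    proof (intro allI impI, elim conjE)
      fix w y
      assume *: "w \<in> Arr E" "y \<in> Arr E" "Dom E w = Dom E y" "Cod E w = Dom E h" "Cod E y = Dom E f" "f \<cdot> y = h \<cdot> w"
      have "\<alpha> \<cdot> (h \<cdot> w) = \<beta> \<cdot> (h \<cdot> w)"
        using comp_reassoc[OF eq] * h ty t\<alpha> t\<beta> by simp
      then have "classifier E a \<cdot> pair E (h \<cdot> w) y = classifier E b \<cdot> pair E (h \<cdot> w) y"
        using transpose_beta[of "classifier E a" X Y "Omega E" "h \<cdot> w" y]
          transpose_beta[of "classifier E b" X Y "Omega E" "h \<cdot> w" y] ty ta tb ma mb * h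
        by (simp add: \<alpha>_def \<beta>_def)
      then have "factors_through E (pair E (h \<cdot> w) y) a = factors_through E (pair E (h \<cdot> w) y) b"
        using classifier_iff[OF ma, of "pair E (h \<cdot> w) y"] classifier_iff[OF mb, of "pair E (h \<cdot> w) y"]
          * h ty ta tb by simp
      then show "factors_through E y k"
        using fa[of "h \<cdot> w" y] fb[of "h \<cdot> w" y] * h ty by simp
    qed
  next
    assume R: ?R
    have "\<alpha> \<cdot> h = \<beta> \<cdot> h"
    proof (rule Exp_ext[where Y = "Omega E" and X = Y])
      fix w y
      assume *: "w \<in> Arr E" "y \<in> Arr E" "Dom E w = Dom E y" "Cod E w = Dom E (\<beta> \<cdot> h)" "Cod E y = Y"
      have w: "Cod E w = Dom E h"
        using * h t\<beta> ty by simp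
      have "classifier E a \<cdot> pair E (h \<cdot> w) y = classifier E b \<cdot> pair E (h \<cdot> w) y"
      proof (rule Omega_ext)
        fix v
        assume v: "v \<in> Arr E" "Cod E v = Dom E (classifier E b \<cdot> pair E (h \<cdot> w) y)"
        then have v: "v \<in> Arr E" "Cod E v = Dom E y"
          using * h w ty mb tb by auto
        have "factors_through E (pair E (h \<cdot> (w \<cdot> v)) (y \<cdot> v)) a \<longleftrightarrow> factors_through E (pair E (h \<cdot> (w \<cdot> v)) (y \<cdot> v)) b"
          using fa[of "h \<cdot> (w \<cdot> v)" "y \<cdot> v"] fb[of "h \<cdot> (w \<cdot> v)" "y \<cdot> v"] R[rule_format, of "w \<cdot> v" "y \<cdot> v"]
            v * w h ty by auto
        then show "(classifier E a \<cdot> pair E (h \<cdot> w) y) \<cdot> v = tru (Dom E v) \<longleftrightarrow>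
           (classifier E b \<cdot> pair E (h \<cdot> w) y) \<cdot> v = tru (Dom E v)"
          using classifier_iff[OF ma, of "pair E (h \<cdot> (w \<cdot> v)) (y \<cdot> v)"]
            classifier_iff[OF mb, of "pair E (h \<cdot> (w \<cdot> v)) (y \<cdot> v)"]
            v * h w ty ta tb ma mb by simp
      qed (use * w h ty ta tb ma mb in simp_all)
      then show "Ev E (Omega E) Y \<cdot> pair E ((\<alpha> \<cdot> h) \<cdot> w) y = Ev E (Omega E) Y \<cdot> pair E ((\<beta> \<cdot> h) \<cdot> w) y"
        using transpose_beta[of "classifier E a" X Y "Omega E" "h \<cdot> w" y]
          transpose_beta[of "classifier E b" X Y "Omega E" "h \<cdot> w" y] ty ta tb ma mb * h w t\<alpha> t\<beta>
        by (simp add: \<alpha>_def \<beta>_def)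
    qed (use h ty t\<alpha> t\<beta> in simp_all)
    then show "factors_through E h q"
      using q(3)[of h] h ty by simp
  qed
  then show thesis
    using that q(1,2) ty by simp
qed

section \<open>Initial objects and negation\<close>

text \<open>The arrow x \<mapsto> {x} into the power object, as the transpose of the equality
  predicate.\<close>

definition sing :: "'o \<Rightarrow> 'a" where
  "sing X = transpose E X X (Omega E) (classifier E (pair E (Idn E X) (Idn E X)))"

lemma monic_diag [simp]: "X \<in> Obj E \<Longrightarrow> monic E (pair E (Idn E X) (Idn E X))"
proof (rule monicI)
  fix f g
  assume *: "X \<in> Obj E" "f \<in> Arr E" "g \<in> Arr E" "Dom E f = Dom E g"
    "Cod E f = Dom E (pair E (Idn E X) (Idn E X))" "Cod E g = Dom E (pair E (Idn E X) (Idn E X))"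
    "pair E (Idn E X) (Idn E X) \<cdot> f = pair E (Idn E X) (Idn E X) \<cdot> g"
  then have "pair E f f = pair E g g"
    by simp
  then show "f = g"
    by (rule pair_inject) (use * in auto)
qed simp

lemma factors_diag:
  assumes "x \<in> Arr E" "y \<in> Arr E" "Dom E x = Dom E y" "Cod E x = X" "Cod E y = X"
  shows "factors_through E (pair E x y) (pair E (Idn E X) (Idn E X)) \<longleftrightarrow> x = y"
proof
  have X: "X \<in> Obj E"
    using assms by auto
  {
    assume "factors_through E (pair E x y) (pair E (Idn E X) (Idn E X))"
    then obtain h where h: "pair E (Idn E X) (Idn E X) \<cdot> h = pair E x y" "h \<in> Arr E"
      "Dom E h = Dom E (pair E x y)" "Cod E h = Dom E (pair E (Idn E X) (Idn E X))"
      by (rule factorsE)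
    then have *: "pair E h h = pair E x y"
      using X by simp
    have "h = x"
      by (rule pair_inject(1)[OF *]) (use h assms X in auto)
    moreover have "h = y"
      by (rule pair_inject(2)[OF *]) (use h assms X in auto)
    ultimately show "x = y"
      by simp
  next
    assume "x = y"
    then show "factors_through E (pair E x y) (pair E (Idn E X) (Idn E X))"
      using X assms by (intro factorsI[of _ y]) auto
  }
qed

lemma classifier_diag:
  assumes "x \<in> Arr E" "y \<in> Arr E" "Dom E x = Dom E y" "Cod E x = X" "Cod E y = X"
  shows "classifier E (pair E (Idn E X) (Idn E X)) \<cdot> pair E x y = tru (Dom E y) \<longleftrightarrow> x = y"
proof -
  have "X \<in> Obj E"
    using assms by auto
  then show ?thesis
    using classifier_iff[of "pair E (Idn E X) (Idn E X)" "pair E x y"] factors_diag[OF assms] assms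
    by simp
qed

lemma sing_in_Arr [simp]:
  assumes "X \<in> Obj E"
  shows "sing X \<in> Arr E" "Dom E (sing X) = X" "Cod E (sing X) = Exp E (Omega E) X"
  using assms by (simp_all add: sing_def)

text \<open>Evaluate {f} = {g} at g: since g belongs to {g}, it belongs to {f}, which means f =
  g.\<close>

lemma monic_sing:
  assumes X: "X \<in> Obj E"
  shows "monic E (sing X)"
proof (rule monicI)
  fix f g
  assume *: "f \<in> Arr E" "g \<in> Arr E" "Dom E f = Dom E g" "Cod E f = Dom E (sing X)" "Cod E g = Dom E (sing X)"
    "sing X \<cdot> f = sing X \<cdot> g"
  let ?d = "classifier E (pair E (Idn E X) (Idn E X))"
  have "Ev E (Omega E) X \<cdot> pair E (sing X \<cdot> h) g = ?d \<cdot> pair E h g"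
    if "h \<in> Arr E" "Dom E h = Dom E g" "Cod E h = X" for h
    unfolding sing_def by (rule transpose_beta) (use X * that in auto)
  from this[of f] this[of g] have "?d \<cdot> pair E f g = ?d \<cdot> pair E g g"
    using * X by simp
  also have "\<dots> = tru (Dom E g)"
    using classifier_diag[of g g X] * X by simp
  finally show "f = g"
    using classifier_diag[of f g X] * X by simp
qed (use X in simp)

section \<open>Initial objects and their strictness\<close>

lemma initialD:
  assumes "initial E Z" "f \<in> Arr E" "g \<in> Arr E" "Dom E f = Z" "Dom E g = Z" "Cod E f = Cod E g"
  shows "f = g"
proof -
  have "\<exists>!f. f \<in> Hom E Z (Cod E g)"
    using assms unfolding initial_def by auto
  moreover have "f \<in> Hom E Z (Cod E g)" "g \<in> Hom E Z (Cod E g)"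
    using assms by auto
  ultimately show ?thesis
    by blast
qed

text \<open>
  An initial object is the truth value saying that all truth values are true. It forces all
  predicates to hold, hence parallel arrows to agree and every subobject to be everything; the
  subobject given by \<open>sing Y\<close> then yields an arrow into \<open>Y\<close>.
\<close>

lemma initial_criterion_ex:
  "\<exists>Z. initial E Z \<and> (\<forall>h \<in> Arr E. Cod E h = Z \<longrightarrow> initial E (Dom E h))"
proof -
  let ?\<Omega> = "Omega E"
  define a b where "a = transpose E (One E) ?\<Omega> ?\<Omega> (Pr2 E (One E) ?\<Omega>)"
    and "b = transpose E (One E) ?\<Omega> ?\<Omega> (tru (Prod E (One E) ?\<Omega>))"
  have ta: "a \<in> Arr E" "Dom E a = One E" "Cod E a = Exp E ?\<Omega> ?\<Omega>"
    and tb: "b \<in> Arr E" "Dom E b = One E" "Cod E b = Exp E ?\<Omega> ?\<Omega>"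
    by (simp_all add: a_def b_def)
  obtain e where e: "monic E e" "Cod E e = One E"
    "\<And>w. w \<in> Arr E \<Longrightarrow> Cod E w = One E \<Longrightarrow> factors_through E w e \<longleftrightarrow> a \<cdot> w = b \<cdot> w"
    using equalizer_ex[of a b] ta tb by auto
  have key: "\<chi> = tru (Dom E h)"
    if h: "h \<in> Arr E" "Cod E h = Dom E e" and c: "\<chi> \<in> Arr E" "Dom E \<chi> = Dom E h" "Cod E \<chi> = ?\<Omega>" for h \<chi>
  proof -
    have "factors_through E (e \<cdot> h) e"
      using h e by (intro factorsI[of e h]) auto
    then have eq: "a \<cdot> (e \<cdot> h) = b \<cdot> (e \<cdot> h)"
      using e(3)[of "e \<cdot> h"] e(1,2) h by simp
    have "Ev E ?\<Omega> ?\<Omega> \<cdot> pair E (a \<cdot> (e \<cdot> h)) \<chi> = Pr2 E (One E) ?\<Omega> \<cdot> pair E (e \<cdot> h) \<chi>"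
      unfolding a_def by (rule transpose_beta) (use h c e in auto)
    moreover have "Ev E ?\<Omega> ?\<Omega> \<cdot> pair E (b \<cdot> (e \<cdot> h)) \<chi> = tru (Prod E (One E) ?\<Omega>) \<cdot> pair E (e \<cdot> h) \<chi>"
      unfolding b_def by (rule transpose_beta) (use h c e in auto)
    ultimately show ?thesis
      using eq h c e by simp
  qed
  have init: "initial E (Dom E h)" if h: "h \<in> Arr E" "Cod E h = Dom E e" for h
    unfolding initial_def
  proof (intro conjI ballI)
    show "Dom E h \<in> Obj E"
      using h by simp
    fix Y
    assume Y: "Y \<in> Obj E"
    define s where "s = transpose E (Dom E h) Y ?\<Omega> (tru (Prod E (Dom E h) Y))"
    have s: "s \<in> Arr E" "Dom E s = Dom E h" "Cod E s = Exp E ?\<Omega> Y"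
      using h Y by (simp_all add: s_def)
    have "classifier E (sing Y) \<cdot> s = tru (Dom E h)"
      by (rule key[OF h]) (use s Y monic_sing[OF Y] in simp_all)
    then have "factors_through E s (sing Y)"
      using classifier_iff[OF monic_sing[OF Y], of s] s Y by simp
    then obtain f where f: "f \<in> Arr E" "Dom E f = Dom E s" "Cod E f = Dom E (sing Y)"
      by (rule factorsE)
    show "\<exists>!f. f \<in> Hom E (Dom E h) Y"
    proof (rule ex1I[of _ f])
      show "f \<in> Hom E (Dom E h) Y"
        using f s Y by simp
      fix g
      assume g: "g \<in> Hom E (Dom E h) Y"
      have "classifier E (pair E (Idn E Y) (Idn E Y)) \<cdot> pair E g f = tru (Dom E h)"
        by (rule key[OF h]) (use f g s Y in simp_all)
      then show "g = f"
        using classifier_diag[of g f Y] f g s Y by simp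
    qed
  qed
  have "initial E (Dom E e)"
    using init[of "Idn E (Dom E e)"] e(1) by simp
  then show ?thesis
    using init by blast
qed

lemma initial_ex: "\<exists>Z. initial E Z"
  using initial_criterion_ex by blast

text \<open>Only the initial object just constructed is known to be strict. Any other one maps to
  it, and composing with that arrow transfers strictness.\<close>

lemma initial_strict:
  assumes "initial E Z" "h \<in> Arr E" "Cod E h = Z"
  shows "initial E (Dom E h)"
proof -
  obtain Z0 where Z0: "initial E Z0" "\<And>h. h \<in> Arr E \<Longrightarrow> Cod E h = Z0 \<Longrightarrow> initial E (Dom E h)"
    using initial_criterion_ex by blast
  have "Z0 \<in> Obj E"
    using Z0 by (simp add: initial_def)
  then obtain k where "k \<in> Hom E Z Z0"
    using assms(1) unfolding initial_def by blast
  then show ?thesis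
    using Z0(2)[of "k \<cdot> h"] assms by simp
qed

lemma initial_factors:
  assumes "initial E (Dom E w)" "w \<in> Arr E" "m \<in> Arr E" "Cod E w = Cod E m"
  shows "factors_through E w m"
proof -
  obtain h where h: "h \<in> Hom E (Dom E w) (Dom E m)"
    using assms(1) assms(3) unfolding initial_def by (metis Dom_in_Obj)
  moreover have "m \<cdot> h = w"
    by (rule initialD[OF assms(1)]) (use h assms in auto)
  ultimately show ?thesis
    by (intro factorsI[of m h]) auto
qed

lemma initial_tru:
  assumes "initial E (Dom E \<chi>)" "\<chi> \<in> Arr E" "Cod E \<chi> = Omega E"
  shows "\<chi> = tru (Dom E \<chi>)"
  by (rule initialD[OF assms(1)]) (use assms in auto)

text \<open>Literally the choice made inside \<open>Fls\<close>, so that \<open>Fls E\<close>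
  becomes the classifier of \<open>Zero\<close> in 1.\<close>

definition Zero :: "'o" where
  "Zero = (SOME Z. initial E Z)"

lemma initial_Zero: "initial E Zero"
  unfolding Zero_def using initial_ex by (rule someI_ex)

lemma Zero_Obj [simp]: "Zero \<in> Obj E"
  using initial_Zero by (simp add: initial_def)

lemma factors_Zero:
  assumes "m \<in> Arr E" "Dom E m = Zero" "factors_through E w m"
  shows "initial E (Dom E w)"
proof -
  obtain h where "h \<in> Arr E" "Dom E h = Dom E w" "Cod E h = Dom E m"
    using assms(3) by (rule factorsE)
  then show ?thesis
    using initial_strict[OF initial_Zero, of h] assms(2) by simp
qed

lemma monic_Zero:
  assumes "m \<in> Arr E" "Dom E m = Zero"
  shows "monic E m"
proof (rule monicI[OF assms(1)])
  fix f g
  assume *: "f \<in> Arr E" "g \<in> Arr E" "Dom E f = Dom E g" "Cod E f = Dom E m" "Cod E g = Dom E m"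
  have "initial E (Dom E g)"
    by (rule initial_strict[OF initial_Zero]) (use * assms in auto)
  then show "f = g"
    by (rule initialD) (use * in auto)
qed

section \<open>The predicate that never holds, and negation\<close>

lemma Fls_eq: "Fls E = classifier E (bang E Zero)"
  by (simp add: Fls_def Zero_def)

lemma Fls_in_Arr [simp]: "Fls E \<in> Arr E" "Dom E (Fls E) = One E" "Cod E (Fls E) = Omega E"
  using monic_Zero[of "bang E Zero"] by (simp_all add: Fls_eq)

definition fal :: "'o \<Rightarrow> 'a" where
  "fal X = Fls E \<cdot> bang E X"

lemma fal_in_Arr [simp]:
  assumes "X \<in> Obj E"
  shows "fal X \<in> Arr E" "Dom E (fal X) = X" "Cod E (fal X) = Omega E"
  using assms by (simp_all add: fal_def)

lemma fal_comp [simp]: "w \<in> Arr E \<Longrightarrow> Cod E w = X \<Longrightarrow> fal X \<cdot> w = fal (Dom E w)"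
  by (auto simp: fal_def)

lemma fal_One: "fal (One E) = Fls E"
  by (simp add: fal_def)

text \<open>If false holds over X, then X has an arrow to \<open>Zero\<close>, and strictness
  applies.\<close>

lemma fal_eq_tru_iff:
  assumes "X \<in> Obj E"
  shows "fal X = tru X \<longleftrightarrow> initial E X"
proof
  have m: "monic E (bang E Zero)"
    by (rule monic_Zero) simp_all
  {
    assume "fal X = tru X"
    then have "factors_through E (bang E X) (bang E Zero)"
      using classifier_iff[OF m, of "bang E X"] assms by (simp add: fal_def Fls_eq)
    then show "initial E X"
      using factors_Zero[of "bang E Zero" "bang E X"] assms by simp
  next
    assume "initial E X"
    then show "fal X = tru X"
      by (rule initialD) (use assms in simp_all)
  }
qed

text \<open>The forcing clause for falsity. A stage at which \<chi> holds would force false, hence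
  is initial; conversely every predicate holds at an initial stage, so agreement with false can be
  checked elementwise.\<close>

lemma eq_fal_iff:
  assumes "\<chi> \<in> Arr E" "Cod E \<chi> = Omega E"
  shows "\<chi> = fal (Dom E \<chi>) \<longleftrightarrow>
    (\<forall>v. v \<in> Arr E \<and> Cod E v = Dom E \<chi> \<and> \<chi> \<cdot> v = tru (Dom E v) \<longrightarrow> initial E (Dom E v))"
proof
  assume *: "\<chi> = fal (Dom E \<chi>)"
  show "\<forall>v. v \<in> Arr E \<and> Cod E v = Dom E \<chi> \<and> \<chi> \<cdot> v = tru (Dom E v) \<longrightarrow> initial E (Dom E v)"
  proof (intro allI impI, elim conjE)
    fix v
    assume v: "v \<in> Arr E" "Cod E v = Dom E \<chi>" "\<chi> \<cdot> v = tru (Dom E v)"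
    have "\<chi> \<cdot> v = fal (Dom E v)"
      by (subst *) (use v assms in simp)
    then show "initial E (Dom E v)"
      using fal_eq_tru_iff[of "Dom E v"] v by simp
  qed
next
  assume *: "\<forall>v. v \<in> Arr E \<and> Cod E v = Dom E \<chi> \<and> \<chi> \<cdot> v = tru (Dom E v) \<longrightarrow> initial E (Dom E v)"
  show "\<chi> = fal (Dom E \<chi>)"
  proof (rule Omega_ext)
    fix w
    assume w: "w \<in> Arr E" "Cod E w = Dom E (fal (Dom E \<chi>))"
    then have w: "w \<in> Arr E" "Cod E w = Dom E \<chi>"
      using assms by auto
    have "initial E (Dom E w) \<Longrightarrow> \<chi> \<cdot> w = tru (Dom E w)"
      using initial_tru[of "\<chi> \<cdot> w"] w assms by simp
    then show "\<chi> \<cdot> w = tru (Dom E w) \<longleftrightarrow> fal (Dom E \<chi>) \<cdot> w = tru (Dom E w)"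
      using * w assms fal_eq_tru_iff[of "Dom E w"] by auto
  qed (use assms in simp_all)
qed

lemma neg_in_Arr [simp]: "neg E \<in> Arr E" "Dom E (neg E) = Omega E" "Cod E (neg E) = Omega E"
  using monic_point[of "Fls E"] by (simp_all add: neg_def)

lemma neg_eq_tru_iff:
  assumes "\<chi> \<in> Arr E" "Cod E \<chi> = Omega E"
  shows "neg E \<cdot> \<chi> = tru (Dom E \<chi>) \<longleftrightarrow> \<chi> = fal (Dom E \<chi>)"
proof -
  have "neg E \<cdot> \<chi> = tru (Dom E \<chi>) \<longleftrightarrow> factors_through E \<chi> (Fls E)"
    unfolding neg_def by (rule classifier_iff) (use assms monic_point in simp_all)
  also have "\<dots> \<longleftrightarrow> \<chi> = fal (Dom E \<chi>)"
  proof
    assume "factors_through E \<chi> (Fls E)"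
    then obtain h where h: "Fls E \<cdot> h = \<chi>" "h \<in> Arr E" "Dom E h = Dom E \<chi>" "Cod E h = Dom E (Fls E)"
      by (rule factorsE)
    moreover have "h = bang E (Dom E \<chi>)"
      by (rule Arr_One_unique) (use h assms in simp_all)
    ultimately show "\<chi> = fal (Dom E \<chi>)"
      by (simp add: fal_def)
  next
    assume "\<chi> = fal (Dom E \<chi>)"
    then show "factors_through E \<chi> (Fls E)"
      using assms by (intro factorsI[of _ "bang E (Dom E \<chi>)"]) (simp_all add: fal_def)
  qed
  finally show ?thesis .
qed

lemma neg_fal [simp]:
  assumes "X \<in> Obj E"
  shows "neg E \<cdot> fal X = tru X"
  using neg_eq_tru_iff[of "fal X"] assms by simp

section \<open>Covers by two subobjects and decidability\<close>

abbreviation diag :: "'o \<Rightarrow> 'a" where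
  "diag X \<equiv> pair E (Idn E X) (Idn E X)"

text \<open>Says that the union of the images of m and n is all of X, without constructing unions.
  The arrows need not be monic, although they are whenever the notion is applied below: a diagonal
  with its complement, or the two points of \<open>Two\<close>.\<close>

definition covers :: "'o \<Rightarrow> 'a \<Rightarrow> 'a \<Rightarrow> bool" where
  "covers X m n \<longleftrightarrow> m \<in> Arr E \<and> n \<in> Arr E \<and> Cod E m = X \<and> Cod E n = X \<and>
    (\<forall>k. monic E k \<and> Cod E k = X \<and> factors_through E m k \<and> factors_through E n k \<longrightarrow>
      factors_through E (Idn E X) k)"

lemma factors_self: "m \<in> Arr E \<Longrightarrow> factors_through E m m"
  by (rule factorsI[of m "Idn E (Dom E m)"]) auto

lemma factors_of_top:
  assumes "factors_through E (Idn E X) k" "k \<in> Arr E" "w \<in> Arr E" "Cod E w = X"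
  shows "factors_through E w k"
  using factors_comp[OF assms(1-3)] assms by auto

text \<open>Pulling back preserves unions because it has a right adjoint. The subobject q from
  \<open>universal_image\<close> contains exactly the h whose pullback along f lies in k. The
  hypotheses put m and n into q, hence q is everything, and transposing back so is k.\<close>

lemma covers_stable:
  assumes c: "covers (Cod E f) m n" and f: "f \<in> Arr E"
    and k: "monic E k" "Cod E k = Dom E f"
    and fm: "\<And>w. w \<in> Arr E \<Longrightarrow> Cod E w = Dom E f \<Longrightarrow> factors_through E (f \<cdot> w) m \<Longrightarrow> factors_through E w k"
    and fn: "\<And>w. w \<in> Arr E \<Longrightarrow> Cod E w = Dom E f \<Longrightarrow> factors_through E (f \<cdot> w) n \<Longrightarrow> factors_through E w k"
  shows "factors_through E (Idn E (Dom E f)) k"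
proof -
  obtain q where q: "monic E q" "Cod E q = Cod E f"
    "\<And>h. h \<in> Arr E \<Longrightarrow> Cod E h = Cod E f \<Longrightarrow> factors_through E h q \<longleftrightarrow>
      (\<forall>w y. w \<in> Arr E \<and> y \<in> Arr E \<and> Dom E w = Dom E y \<and> Cod E w = Dom E h \<and> Cod E y = Dom E f \<and>
        f \<cdot> y = h \<cdot> w \<longrightarrow> factors_through E y k)"
    using universal_image[OF f k] by blast
  have "factors_through E l q"
    if l: "l \<in> Arr E" "Cod E l = Cod E f"
      and fl: "\<And>w. w \<in> Arr E \<Longrightarrow> Cod E w = Dom E f \<Longrightarrow> factors_through E (f \<cdot> w) l \<Longrightarrow> factors_through E w k"
    for l
  proof (rule q(3)[THEN iffD2, OF l], intro allI impI, elim conjE)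
    fix w y
    assume *: "w \<in> Arr E" "y \<in> Arr E" "Dom E w = Dom E y" "Cod E w = Dom E l" "Cod E y = Dom E f" "f \<cdot> y = l \<cdot> w"
    have "factors_through E (f \<cdot> y) l"
      by (rule factorsI[of l w]) (use * l f in auto)
    then show "factors_through E y k"
      using fl * by blast
  qed
  then have "factors_through E (Idn E (Cod E f)) q"
    using c q(1,2) fm fn unfolding covers_def by blast
  then have "\<forall>w y. w \<in> Arr E \<and> y \<in> Arr E \<and> Dom E w = Dom E y \<and> Cod E w = Cod E f \<and> Cod E y = Dom E f \<and>
        f \<cdot> y = Idn E (Cod E f) \<cdot> w \<longrightarrow> factors_through E y k"
    using q(3)[of "Idn E (Cod E f)"] f by simp
  from this[rule_format, of f "Idn E (Dom E f)"] show ?thesis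
    using f by simp
qed

text \<open>The definition controls only subobjects below both parts, whereas disjointness is needed
  for arbitrary w. The part k of n that lies on the diagonal is such a subobject, so it lies below
  the one with domain \<open>Zero\<close>; by strictness k is initial, and so is every stage mapping
  into it.\<close>

lemma decidable_complement:
  assumes "decidable E D"
  obtains n where "monic E n" "Cod E n = Prod E D D" "covers (Prod E D D) (diag D) n"
    "\<And>w. w \<in> Arr E \<Longrightarrow> Cod E w = Prod E D D \<Longrightarrow> factors_through E w (diag D) \<Longrightarrow> factors_through E w n \<Longrightarrow>
      initial E (Dom E w)"
proof -
  have D: "D \<in> Obj E"
    using assms by (simp add: decidable_def)
  obtain n where n: "monic E n" "Cod E n = Prod E D D"
    and meet: "\<And>k l. subobject E (Prod E D D) k \<Longrightarrow> factors_through E k (diag D) \<Longrightarrow> factors_through E k n \<Longrightarrow>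
      subobject E (Prod E D D) l \<Longrightarrow> factors_through E k l"
    and join: "\<And>k l. subobject E (Prod E D D) k \<Longrightarrow> factors_through E (diag D) k \<Longrightarrow> factors_through E n k \<Longrightarrow>
      subobject E (Prod E D D) l \<Longrightarrow> factors_through E l k"
    using assms unfolding decidable_def complemented_def subobject_def by blast
  have "covers (Prod E D D) (diag D) n"
    unfolding covers_def
    using D n join[of _ "Idn E (Prod E D D)"] by (auto simp: subobject_def)
  moreover have "initial E (Dom E w)"
    if w: "w \<in> Arr E" "Cod E w = Prod E D D" and wd: "factors_through E w (diag D)" and wn: "factors_through E w n" for w
  proof -
    define \<chi> where "\<chi> = classifier E (diag D) \<cdot> n"
    have \<chi>: "\<chi> \<in> Arr E" "Dom E \<chi> = Dom E n" "Cod E \<chi> = Omega E"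
      using n D by (simp_all add: \<chi>_def)
    obtain k where k: "monic E k" "Cod E k = Dom E n"
      "\<And>w. w \<in> Arr E \<Longrightarrow> Cod E w = Dom E n \<Longrightarrow> factors_through E w k \<longleftrightarrow> \<chi> \<cdot> w = tru (Dom E w)"
      using subobject_of_predicate[OF \<chi>(1,3)] \<chi>(2) by auto
    have iff: "factors_through E v k \<longleftrightarrow> factors_through E (n \<cdot> v) (diag D)"
      if "v \<in> Arr E" "Cod E v = Dom E n" for v
      using k(3)[OF that] classifier_iff[of "diag D" "n \<cdot> v"] that n D by (simp add: \<chi>_def)
    have sub: "subobject E (Prod E D D) (n \<cdot> k)"
      using monic_comp[OF n(1) k(1,2)] n k by (simp add: subobject_def)
    obtain z where z: "z \<in> Hom E Zero (Prod E D D)"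
      using initial_Zero D unfolding initial_def by (metis Prod_Obj)
    have "factors_through E (n \<cdot> k) z"
    proof (rule meet[OF sub])
      show "factors_through E (n \<cdot> k) (diag D)"
        using iff[of k] k factors_self by simp
      show "factors_through E (n \<cdot> k) n"
        by (rule factorsI[of n k]) (use n k in auto)
      show "subobject E (Prod E D D) z"
        using monic_Zero[of z] z by (simp add: subobject_def)
    qed
    then have ik: "initial E (Dom E k)"
      using factors_Zero[of z "n \<cdot> k"] z n k by simp
    obtain r where r: "n \<cdot> r = w" "r \<in> Arr E" "Dom E r = Dom E w" "Cod E r = Dom E n"
      using wn by (rule factorsE)
    have "factors_through E r k"
      using iff[of r] r wd by simp
    then obtain s where "s \<in> Arr E" "Dom E s = Dom E r" "Cod E s = Dom E k"
      by (rule factorsE)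
    then show ?thesis
      using initial_strict[OF ik, of s] r by simp
  qed
  ultimately show thesis
    using that n by blast
qed

text \<open>Pull the diagonal of the ambient object and its complement back along k \<times> k.
  Since k is monic, the first becomes the diagonal of the smaller object; the pulled back complement
  stays disjoint from it, and by \<open>covers_stable\<close> the two still cover.\<close>

lemma decidable_subobject:
  assumes "monic E k" "decidable E (Cod E k)"
  shows "decidable E (Dom E k)"
proof -
  define D K kk where "D = Cod E k" and "K = Dom E k" and "kk = cross E k k"
  have ty: "D \<in> Obj E" "K \<in> Obj E" "k \<in> Arr E" "Dom E k = K" "Cod E k = D"
    using assms by (auto simp: D_def K_def)
  have tkk: "kk \<in> Arr E" "Dom E kk = Prod E K K" "Cod E kk = Prod E D D"
    using ty by (simp_all add: kk_def)
  obtain n where n: "monic E n" "Cod E n = Prod E D D" "covers (Prod E D D) (diag D) n"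
    and disj: "\<And>w. w \<in> Arr E \<Longrightarrow> Cod E w = Prod E D D \<Longrightarrow> factors_through E w (diag D) \<Longrightarrow> factors_through E w n \<Longrightarrow>
      initial E (Dom E w)"
    using decidable_complement[of D] assms(2) D_def by blast
  have fd: "factors_through E (kk \<cdot> w) (diag D) \<longleftrightarrow> factors_through E w (diag K)"
    if w: "w \<in> Arr E" "Cod E w = Prod E K K" for w
  proof -
    define x y where "x = Pr1 E K K \<cdot> w" and "y = Pr2 E K K \<cdot> w"
    have xy: "x \<in> Arr E" "y \<in> Arr E" "Dom E x = Dom E y" "Cod E x = K" "Cod E y = K"
      using w ty by (simp_all add: x_def y_def)
    have e: "w = pair E x y"
      using pair_eta[of w K K] w ty by (simp add: x_def y_def)
    have "k \<cdot> x = k \<cdot> y \<longleftrightarrow> x = y"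
      using monicD[OF assms(1), of x y] xy ty by auto
    then show ?thesis
      using factors_diag[of x y K] factors_diag[of "k \<cdot> x" "k \<cdot> y" D] xy ty by (simp add: e kk_def)
  qed
  define \<chi> where "\<chi> = classifier E n \<cdot> kk"
  have \<chi>: "\<chi> \<in> Arr E" "Dom E \<chi> = Prod E K K" "Cod E \<chi> = Omega E"
    using n tkk by (simp_all add: \<chi>_def)
  obtain m where m: "monic E m" "Cod E m = Prod E K K"
    "\<And>w. w \<in> Arr E \<Longrightarrow> Cod E w = Prod E K K \<Longrightarrow> factors_through E w m \<longleftrightarrow> \<chi> \<cdot> w = tru (Dom E w)"
    using subobject_of_predicate[OF \<chi>(1,3)] \<chi>(2) by auto
  have fm: "factors_through E w m \<longleftrightarrow> factors_through E (kk \<cdot> w) n"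
    if "w \<in> Arr E" "Cod E w = Prod E K K" for w
    using m(3)[OF that] classifier_iff[of n "kk \<cdot> w"] that n tkk by (simp add: \<chi>_def)
  have "complemented E (Prod E K K) (diag K)"
    unfolding complemented_def
  proof (intro conjI exI[of _ m] allI impI, goal_cases)
    case 1
    show ?case
      using ty by (simp add: subobject_def)
  next
    case 2
    show ?case
      using m by (simp add: subobject_def)
  next
    case (3 w l)
    then have w: "w \<in> Arr E" "Cod E w = Prod E K K" "l \<in> Arr E" "Cod E l = Prod E K K"
      by (auto simp: subobject_def)
    have "initial E (Dom E (kk \<cdot> w))"
      by (rule disj) (use 3 w tkk fd fm in auto)
    then show ?case
      using initial_factors[of w l] w tkk by simp
  next
    case (4 l w)
    then have l: "monic E l" "Cod E l = Prod E K K" and w: "w \<in> Arr E" "Cod E w = Prod E K K"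
      by (auto simp: subobject_def)
    have "factors_through E (Idn E (Dom E kk)) l"
    proof (rule covers_stable[of kk "diag D" n])
      fix v
      assume v: "v \<in> Arr E" "Cod E v = Dom E kk"
      show "factors_through E v l" if "factors_through E (kk \<cdot> v) (diag D)"
        using factors_trans[of v "diag K" l] fd[of v] v tkk that 4 l by simp
      show "factors_through E v l" if "factors_through E (kk \<cdot> v) n"
        using factors_trans[of v m l] fm[of v] v tkk that 4 l by simp
    qed (use n tkk l in simp_all)
    then show ?case
      using factors_of_top[of "Dom E kk" l w] l w tkk by simp
  qed
  then show ?thesis
    using ty by (simp add: decidable_def)
qed

section \<open>Conjunction and contractions\<close>

definition conj :: 'a where
  "conj = classifier E (pair E (Tru E) (Tru E))"

lemma monic_Tru_pair: "monic E (pair E (Tru E) (Tru E))"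
  by (rule monic_point) simp_all

lemma conj_in_Arr [simp]:
  "conj \<in> Arr E" "Dom E conj = Prod E (Omega E) (Omega E)" "Cod E conj = Omega E"
  using monic_Tru_pair by (simp_all add: conj_def)

lemma conj_iff:
  assumes "a \<in> Arr E" "b \<in> Arr E" "Dom E a = Dom E b" "Cod E a = Omega E" "Cod E b = Omega E"
  shows "conj \<cdot> pair E a b = tru (Dom E b) \<longleftrightarrow> a = tru (Dom E b) \<and> b = tru (Dom E b)"
proof -
  have "conj \<cdot> pair E a b = tru (Dom E b) \<longleftrightarrow> factors_through E (pair E a b) (pair E (Tru E) (Tru E))"
    using classifier_iff[OF monic_Tru_pair, of "pair E a b"] assms by (simp add: conj_def)
  also have "\<dots> \<longleftrightarrow> a = tru (Dom E b) \<and> b = tru (Dom E b)"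
  proof
    assume "factors_through E (pair E a b) (pair E (Tru E) (Tru E))"
    then obtain h where h: "pair E (Tru E) (Tru E) \<cdot> h = pair E a b" "h \<in> Arr E"
      "Dom E h = Dom E (pair E a b)" "Cod E h = Dom E (pair E (Tru E) (Tru E))"
      by (rule factorsE)
    have "h = bang E (Dom E b)"
      by (rule Arr_One_unique) (use h assms in simp_all)
    then have *: "pair E (tru (Dom E b)) (tru (Dom E b)) = pair E a b"
      using h(1) assms by (simp add: tru_def)
    show "a = tru (Dom E b) \<and> b = tru (Dom E b)"
      using pair_inject[OF *] assms by simp
  next
    assume "a = tru (Dom E b) \<and> b = tru (Dom E b)"
    moreover have "pair E (Tru E) (Tru E) \<cdot> bang E (Dom E b) = pair E (tru (Dom E b)) (tru (Dom E b))"
      using assms by (simp add: tru_def)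
    ultimately show "factors_through E (pair E a b) (pair E (Tru E) (Tru E))"
      using assms by (intro factorsI[of _ "bang E (Dom E b)"]) simp_all
  qed
  finally show ?thesis .
qed

lemma conj_tru:
  assumes "b \<in> Arr E" "Cod E b = Omega E" "Dom E b = X"
  shows "conj \<cdot> pair E (tru X) b = b"
proof (rule Omega_ext)
  fix w
  assume "w \<in> Arr E" "Cod E w = Dom E b"
  then show "(conj \<cdot> pair E (tru X) b) \<cdot> w = tru (Dom E w) \<longleftrightarrow> b \<cdot> w = tru (Dom E w)"
    using conj_iff[of "tru (Dom E w)" "b \<cdot> w"] assms by auto
qed (use assms in auto)

lemma conj_fal:
  assumes "b \<in> Arr E" "Cod E b = Omega E" "Dom E b = X"
  shows "conj \<cdot> pair E (fal X) b = fal X"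
proof (rule Omega_ext)
  fix w
  assume "w \<in> Arr E" "Cod E w = Dom E (fal X)"
  moreover have "X \<in> Obj E"
    using assms by auto
  ultimately show "(conj \<cdot> pair E (fal X) b) \<cdot> w = tru (Dom E w) \<longleftrightarrow> fal X \<cdot> w = tru (Dom E w)"
    using conj_iff[of "fal (Dom E w)" "b \<cdot> w"] fal_eq_tru_iff[of "Dom E w"] initial_tru[of "b \<cdot> w"] assms
    by auto
qed (use assms in auto)

text \<open>Both ends of the homotopy are stated for generalized elements x, because
  \<open>connected_Exp\<close> applies H inside a function object, where points would not
  suffice.\<close>

definition contraction :: "'o \<Rightarrow> 'a \<Rightarrow> 'a \<Rightarrow> bool" where
  "contraction A a H \<longleftrightarrow> H \<in> Hom E (Prod E (Omega E) A) A \<and> a \<in> Hom E (One E) A \<and>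
    (\<forall>x. x \<in> Arr E \<and> Cod E x = A \<longrightarrow>
      H \<cdot> pair E (tru (Dom E x)) x = x \<and> H \<cdot> pair E (fal (Dom E x)) x = a \<cdot> bang E (Dom E x))"

lemma contraction_Omega: "contraction (Omega E) (Fls E) conj"
  unfolding contraction_def using conj_tru conj_fal by (auto simp: fal_def)

text \<open>Pointwise conjunction sends (\<omega>, S) to the set of x in S for which \<omega> holds.
  At true this is S, at false the empty set, and a is the name of the empty set.\<close>

lemma contraction_power:
  assumes X: "X \<in> Obj E"
  obtains a H where "contraction (Exp E (Omega E) X) a H"
proof -
  let ?\<Omega> = "Omega E" and ?A = "Exp E (Omega E) X"
  let ?Z = "Prod E ?\<Omega> ?A"
  let ?P1 = "Pr1 E ?Z X" and ?P2 = "Pr2 E ?Z X"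
  define h where "h = conj \<cdot> pair E (Pr1 E ?\<Omega> ?A \<cdot> ?P1) (Ev E ?\<Omega> X \<cdot> pair E (Pr2 E ?\<Omega> ?A \<cdot> ?P1) ?P2)"
  define H where "H = transpose E ?Z X ?\<Omega> h"
  define a where "a = transpose E (One E) X ?\<Omega> (fal (Prod E (One E) X))"
  have h: "h \<in> Arr E" "Dom E h = Prod E ?Z X" "Cod E h = ?\<Omega>"
    using X by (simp_all add: h_def)
  have H: "H \<in> Arr E" "Dom E H = ?Z" "Cod E H = ?A"
    using X h by (simp_all add: H_def)
  have a: "a \<in> Arr E" "Dom E a = One E" "Cod E a = ?A"
    using X by (simp_all add: a_def)
  have Hb: "Ev E ?\<Omega> X \<cdot> pair E (H \<cdot> pair E u s) x = conj \<cdot> pair E u (Ev E ?\<Omega> X \<cdot> pair E s x)"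
    if "u \<in> Arr E" "s \<in> Arr E" "x \<in> Arr E" "Dom E u = Dom E x" "Dom E s = Dom E x" "Cod E u = ?\<Omega>"
      "Cod E s = ?A" "Cod E x = X" for u s x
  proof -
    have "Ev E ?\<Omega> X \<cdot> pair E (H \<cdot> pair E u s) x = h \<cdot> pair E (pair E u s) x"
      unfolding H_def by (rule transpose_beta) (use h X that in simp_all)
    then show ?thesis
      using that X by (simp add: h_def)
  qed
  have ab: "Ev E ?\<Omega> X \<cdot> pair E (a \<cdot> u) x = fal (Dom E x)"
    if "u \<in> Arr E" "x \<in> Arr E" "Dom E u = Dom E x" "Cod E u = One E" "Cod E x = X" for u x
  proof -
    have "Ev E ?\<Omega> X \<cdot> pair E (a \<cdot> u) x = fal (Prod E (One E) X) \<cdot> pair E u x"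
      unfolding a_def by (rule transpose_beta) (use X that in simp_all)
    then show ?thesis
      using that X by simp
  qed
  have "contraction ?A a H"
    unfolding contraction_def
  proof (intro conjI allI impI)
    show "H \<in> Hom E ?Z ?A" "a \<in> Hom E (One E) ?A"
      using a H by simp_all
    fix s
    assume "s \<in> Arr E \<and> Cod E s = ?A"
    then have s: "s \<in> Arr E" "Cod E s = ?A"
      by simp_all
    show "H \<cdot> pair E (tru (Dom E s)) s = s"
    proof (rule Exp_ext[where Y = ?\<Omega> and X = X])
      fix w x
      assume w: "w \<in> Arr E" "x \<in> Arr E" "Dom E w = Dom E x" "Cod E w = Dom E s" "Cod E x = X"
      then show "Ev E ?\<Omega> X \<cdot> pair E ((H \<cdot> pair E (tru (Dom E s)) s) \<cdot> w) x = Ev E ?\<Omega> X \<cdot> pair E (s \<cdot> w) x"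
        using s H X Hb[of "tru (Dom E x)" "s \<cdot> w" x] conj_tru[of "Ev E ?\<Omega> X \<cdot> pair E (s \<cdot> w) x"] by simp
    qed (use s H X in simp_all)
    show "H \<cdot> pair E (fal (Dom E s)) s = a \<cdot> bang E (Dom E s)"
    proof (rule Exp_ext[where Y = ?\<Omega> and X = X])
      fix w x
      assume w: "w \<in> Arr E" "x \<in> Arr E" "Dom E w = Dom E x" "Cod E w = Dom E (a \<cdot> bang E (Dom E s))" "Cod E x = X"
      then have "Cod E w = Dom E s"
        using a s by simp
      then show "Ev E ?\<Omega> X \<cdot> pair E ((H \<cdot> pair E (fal (Dom E s)) s) \<cdot> w) x = Ev E ?\<Omega> X \<cdot> pair E ((a \<cdot> bang E (Dom E s)) \<cdot> w) x"
        using w s H X a Hb[of "fal (Dom E x)" "s \<cdot> w" x] conj_fal[of "Ev E ?\<Omega> X \<cdot> pair E (s \<cdot> w) x"]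
          ab[of "bang E (Dom E x)" x] by simp
    qed (use s H X a in simp_all)
  qed
  then show thesis
    by (rule that)
qed

text \<open>Evaluation at a fixed point is made an arrow out of the exponential, so that
  \<open>indist_image\<close> can pass from names of arrows to their values.\<close>

definition eval_at :: "'o \<Rightarrow> 'o \<Rightarrow> 'a \<Rightarrow> 'a" where
  "eval_at Y X x = Ev E Y X \<cdot> pair E (Idn E (Exp E Y X)) (x \<cdot> bang E (Exp E Y X))"

lemma eval_at:
  assumes "x \<in> Arr E" "Dom E x = One E" "Cod E x = X" "Y \<in> Obj E"
  shows "eval_at Y X x \<in> Arr E" "Dom E (eval_at Y X x) = Exp E Y X" "Cod E (eval_at Y X x) = Y"
    "k \<in> Arr E \<Longrightarrow> Dom E k = One E \<Longrightarrow> Cod E k = Exp E Y X \<Longrightarrow> eval_at Y X x \<cdot> k = Ev E Y X \<cdot> pair E k x"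
proof -
  have "X \<in> Obj E"
    using assms by auto
  then show "eval_at Y X x \<in> Arr E" "Dom E (eval_at Y X x) = Exp E Y X" "Cod E (eval_at Y X x) = Y"
    "k \<in> Arr E \<Longrightarrow> Dom E k = One E \<Longrightarrow> Cod E k = Exp E Y X \<Longrightarrow> eval_at Y X x \<cdot> k = Ev E Y X \<cdot> pair E k x"
    using assms by (simp_all add: eval_at_def)
qed

lemma name_of_in_Arr [simp]:
  assumes "f \<in> Arr E"
  shows "name_of E f \<in> Arr E" "Dom E (name_of E f) = One E" "Cod E (name_of E f) = Exp E (Cod E f) (Dom E f)"
  using assms by (simp_all add: name_of_def)

lemma eval_name:
  assumes "f \<in> Arr E" "x \<in> Arr E" "Dom E x = One E" "Cod E x = Dom E f"
  shows "eval_at (Cod E f) (Dom E f) x \<cdot> name_of E f = f \<cdot> x"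
proof -
  let ?h = "f \<cdot> Pr2 E (One E) (Dom E f)"
  have "Ev E (Cod E f) (Dom E f) \<cdot> pair E (name_of E f \<cdot> Idn E (One E)) x = ?h \<cdot> pair E (Idn E (One E)) x"
    unfolding name_of_def by (rule transpose_beta) (use assms in simp_all)
  then show ?thesis
    using eval_at(4)[of x "Dom E f" "Cod E f" "name_of E f"] assms by simp
qed

section \<open>Double-negation sheaves\<close>

lemma neg_forces:
  assumes "\<chi> \<in> Arr E" "Cod E \<chi> = Omega E"
  shows "neg E \<cdot> \<chi> = tru (Dom E \<chi>) \<longleftrightarrow>
    (\<forall>v. v \<in> Arr E \<and> Cod E v = Dom E \<chi> \<and> \<chi> \<cdot> v = tru (Dom E v) \<longrightarrow> initial E (Dom E v))"
  using neg_eq_tru_iff[OF assms] eq_fal_iff[OF assms] by simp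

lemma neg_forcesI:
  assumes "\<chi> \<in> Arr E" "Cod E \<chi> = Omega E" "Dom E \<chi> = X"
    and "\<And>v. v \<in> Arr E \<Longrightarrow> Cod E v = X \<Longrightarrow> \<chi> \<cdot> v = tru (Dom E v) \<Longrightarrow> initial E (Dom E v)"
  shows "neg E \<cdot> \<chi> = tru X"
  using neg_forces[OF assms(1,2)] assms(3,4) by blast

lemma neg_tru_contradiction:
  assumes "\<chi> \<in> Arr E" "Cod E \<chi> = Omega E" "\<chi> = tru (Dom E \<chi>)" "neg E \<cdot> \<chi> = tru (Dom E \<chi>)"
  shows "initial E (Dom E \<chi>)"
  using neg_eq_tru_iff[OF assms(1,2)] fal_eq_tru_iff[of "Dom E \<chi>"] assms by simp

lemma neg_neg_tru:
  assumes "\<chi> \<in> Arr E" "Cod E \<chi> = Omega E" "\<chi> = tru (Dom E \<chi>)"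
  shows "neg E \<cdot> (neg E \<cdot> \<chi>) = tru (Dom E \<chi>)"
proof (rule neg_forcesI)
  fix v
  assume v: "v \<in> Arr E" "Cod E v = Dom E \<chi>" "(neg E \<cdot> \<chi>) \<cdot> v = tru (Dom E v)"
  have "\<chi> \<cdot> v = tru (Dom E v)"
    by (subst assms(3)) (use v assms(1,2) in simp)
  then show "initial E (Dom E v)"
    using neg_tru_contradiction[of "\<chi> \<cdot> v"] v assms(1,2) by simp
qed (use assms(1,2) in simp_all)

text \<open>The intuitionistic law that three negations amount to one. It makes every doubly negated
  predicate regular, as the extension built in \<open>sheaf_regular\<close> requires.\<close>

lemma neg_neg_neg:
  assumes "\<chi> \<in> Arr E" "Cod E \<chi> = Omega E"
  shows "neg E \<cdot> (neg E \<cdot> (neg E \<cdot> \<chi>)) = neg E \<cdot> \<chi>"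
proof (rule Omega_ext)
  fix w
  assume "w \<in> Arr E" "Cod E w = Dom E (neg E \<cdot> \<chi>)"
  then have w: "w \<in> Arr E" "Cod E w = Dom E \<chi>"
    using assms by simp_all
  define \<psi> where "\<psi> = \<chi> \<cdot> w"
  have \<psi>: "\<psi> \<in> Arr E" "Cod E \<psi> = Omega E" "Dom E \<psi> = Dom E w"
    using w assms by (simp_all add: \<psi>_def)
  have "neg E \<cdot> \<psi> = tru (Dom E \<psi>)" if 3: "neg E \<cdot> (neg E \<cdot> (neg E \<cdot> \<psi>)) = tru (Dom E \<psi>)"
  proof (rule neg_forcesI)
    fix v
    assume v: "v \<in> Arr E" "Cod E v = Dom E \<psi>" "\<psi> \<cdot> v = tru (Dom E v)"
    have "neg E \<cdot> (neg E \<cdot> (\<psi> \<cdot> v)) = tru (Dom E v)"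
      using neg_neg_tru[of "\<psi> \<cdot> v"] v \<psi> by simp
    moreover have "neg E \<cdot> (neg E \<cdot> (neg E \<cdot> (\<psi> \<cdot> v))) = tru (Dom E v)"
      using comp_reassoc[OF 3, of v] v \<psi> by simp
    ultimately show "initial E (Dom E v)"
      using neg_tru_contradiction[of "neg E \<cdot> (neg E \<cdot> (\<psi> \<cdot> v))"] v \<psi> by simp
  qed (use \<psi> in simp_all)
  moreover have "neg E \<cdot> (neg E \<cdot> (neg E \<cdot> \<psi>)) = tru (Dom E \<psi>)" if "neg E \<cdot> \<psi> = tru (Dom E \<psi>)"
  proof -
    have "neg E \<cdot> (neg E \<cdot> (neg E \<cdot> \<psi>)) = tru (Dom E (neg E \<cdot> \<psi>))"
      by (rule neg_neg_tru) (use that \<psi> w in simp_all)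
    then show ?thesis
      using \<psi> by simp
  qed
  ultimately show "(neg E \<cdot> (neg E \<cdot> (neg E \<cdot> \<chi>))) \<cdot> w = tru (Dom E w) \<longleftrightarrow> (neg E \<cdot> \<chi>) \<cdot> w = tru (Dom E w)"
    using w assms \<psi> by (auto simp: \<psi>_def)
qed (use assms in simp_all)

section \<open>Dense subobjects and the sheaf of regular truth values\<close>

lemma dense_iff:
  "dense E (dneg E) m \<longleftrightarrow> monic E m \<and> neg E \<cdot> (neg E \<cdot> classifier E m) = tru (Cod E m)"
  by (auto simp: dense_def dneg_def tru_def)

text \<open>As \<psi> is regular, only its double negation has to be forced at w. At a stage where
  \<psi> is refuted, \<phi> still holds, so no part of the element lies in m, where the two
  predicates agree. Density allows this only over an initial stage.\<close>

lemma dense_implies: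
  assumes m: "dense E (dneg E) m"
    and \<phi>: "\<phi> \<in> Arr E" "Dom E \<phi> = Cod E m" "Cod E \<phi> = Omega E"
    and \<psi>: "\<psi> \<in> Arr E" "Dom E \<psi> = Cod E m" "Cod E \<psi> = Omega E" "neg E \<cdot> (neg E \<cdot> \<psi>) = \<psi>"
    and eq: "\<phi> \<cdot> m = \<psi> \<cdot> m"
    and w: "w \<in> Arr E" "Cod E w = Cod E m" "\<phi> \<cdot> w = tru (Dom E w)"
  shows "\<psi> \<cdot> w = tru (Dom E w)"
proof -
  have mm: "monic E m" and d: "neg E \<cdot> (neg E \<cdot> classifier E m) = tru (Cod E m)"
    using m by (simp_all add: dense_iff)
  have "neg E \<cdot> (neg E \<cdot> (\<psi> \<cdot> w)) = tru (Dom E w)"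
  proof (rule neg_forcesI)
    fix v
    assume "v \<in> Arr E" "Cod E v = Dom E w" "(neg E \<cdot> (\<psi> \<cdot> w)) \<cdot> v = tru (Dom E v)"
    then have v: "v \<in> Arr E" "Cod E v = Dom E w" "neg E \<cdot> (\<psi> \<cdot> (w \<cdot> v)) = tru (Dom E v)"
      using w(1,2) \<psi>(1-3) by simp_all
    let ?\<mu> = "classifier E m \<cdot> (w \<cdot> v)"
    have "neg E \<cdot> ?\<mu> = tru (Dom E ?\<mu>)"
    proof (rule neg_forcesI)
      fix u
      assume "u \<in> Arr E" "Cod E u = Dom E ?\<mu>" "?\<mu> \<cdot> u = tru (Dom E u)"
      then have u: "u \<in> Arr E" "Cod E u = Dom E v" "classifier E m \<cdot> (w \<cdot> (v \<cdot> u)) = tru (Dom E u)"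
        using w(1,2) v(1,2) mm by simp_all
      then have "factors_through E (w \<cdot> (v \<cdot> u)) m"
        using classifier_iff[OF mm, of "w \<cdot> (v \<cdot> u)"] v w by simp
      then obtain s where s: "m \<cdot> s = w \<cdot> (v \<cdot> u)" "s \<in> Arr E" "Dom E s = Dom E (w \<cdot> (v \<cdot> u))" "Cod E s = Dom E m"
        by (rule factorsE)
      have "\<psi> \<cdot> (m \<cdot> s) = (\<phi> \<cdot> m) \<cdot> s"
        by (rule comp_reassoc[OF eq[symmetric]]) (use s \<psi> mm in simp_all)
      then have "\<psi> \<cdot> (m \<cdot> s) = \<phi> \<cdot> (m \<cdot> s)"
        using s(2-4) \<phi> mm by simp
      then have "\<psi> \<cdot> (w \<cdot> (v \<cdot> u)) = \<phi> \<cdot> (w \<cdot> (v \<cdot> u))"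
        by (simp only: s(1))
      also have "\<dots> = tru (Dom E u)"
        using comp_reassoc[OF w(3), of "v \<cdot> u"] w u v \<phi> by simp
      finally show "initial E (Dom E u)"
        using neg_forces[of "\<psi> \<cdot> (w \<cdot> v)"] u v w \<psi>(1-3) by simp
    qed (use v w mm in simp_all)
    moreover have "neg E \<cdot> (neg E \<cdot> ?\<mu>) = tru (Dom E ?\<mu>)"
      using comp_reassoc[OF d, of "w \<cdot> v"] v w mm by simp
    ultimately have "initial E (Dom E (neg E \<cdot> ?\<mu>))"
      by (intro neg_tru_contradiction) (use v w mm in simp_all)
    then show "initial E (Dom E v)"
      using v w mm by simp
  qed (use w \<psi>(1-3) in simp_all)
  moreover have "neg E \<cdot> (neg E \<cdot> (\<psi> \<cdot> w)) = \<psi> \<cdot> w"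
    using comp_reassoc[OF \<psi>(4), of w] w \<psi>(1-3) by simp
  ultimately show ?thesis
    using w \<psi>(1-3) by simp
qed

text \<open>An arrow into the regular truth values is a regular predicate. To extend it along a
  dense m, regard its extent as a subobject of the codomain of m and doubly negate the classifier.
  Uniqueness is \<open>dense_implies\<close> used in both directions.\<close>

lemma sheaf_regular:
  assumes e: "monic E e" "Cod E e = Omega E"
    and e_iff: "\<And>w. w \<in> Arr E \<Longrightarrow> Cod E w = Omega E \<Longrightarrow>
      factors_through E w e \<longleftrightarrow> neg E \<cdot> (neg E \<cdot> w) = w"
  shows "sheaf E (dneg E) (Dom E e)"
  unfolding sheaf_def
proof (intro conjI allI impI ballI)
  show "Dom E e \<in> Obj E"
    using e by simp
  have reg: "neg E \<cdot> (neg E \<cdot> (e \<cdot> f)) = e \<cdot> f" if "f \<in> Arr E" "Cod E f = Dom E e" for f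
    using e_iff[of "e \<cdot> f"] factorsI[of e f "e \<cdot> f"] that e by simp
  fix m f
  assume m: "dense E (dneg E) m" and f: "f \<in> Hom E (Dom E m) (Dom E e)"
  have mm: "monic E m"
    using m by (simp add: dense_iff)
  define \<chi> where "\<chi> = e \<cdot> f"
  have \<chi>: "\<chi> \<in> Arr E" "Dom E \<chi> = Dom E m" "Cod E \<chi> = Omega E" "neg E \<cdot> (neg E \<cdot> \<chi>) = \<chi>"
    using f e reg[of f] by (simp_all add: \<chi>_def)
  obtain k where k: "monic E k" "Cod E k = Dom E \<chi>"
    "\<And>w. w \<in> Arr E \<Longrightarrow> Cod E w = Dom E \<chi> \<Longrightarrow> factors_through E w k \<longleftrightarrow> \<chi> \<cdot> w = tru (Dom E w)"
    using subobject_of_predicate[OF \<chi>(1,3)] by blast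
  have mk: "monic E (m \<cdot> k)"
    using monic_comp[OF mm k(1)] k \<chi> by simp
  define \<psi> where "\<psi> = classifier E (m \<cdot> k)"
  have \<psi>: "\<psi> \<in> Arr E" "Dom E \<psi> = Cod E m" "Cod E \<psi> = Omega E"
    using mk mm k \<chi> by (simp_all add: \<psi>_def)
  \<comment> \<open>Pulling the image m \<cdot> k back along the monic m returns k.\<close>
  have "\<psi> \<cdot> m = \<chi>"
  proof (rule Omega_ext)
    fix w
    assume w: "w \<in> Arr E" "Cod E w = Dom E \<chi>"
    have "\<psi> \<cdot> (m \<cdot> w) = tru (Dom E w) \<longleftrightarrow> factors_through E (m \<cdot> w) (m \<cdot> k)"
      using classifier_iff[OF mk, of "m \<cdot> w"] w \<chi> mm k by (simp add: \<psi>_def)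
    also have "\<dots> \<longleftrightarrow> factors_through E w k"
    proof
      assume "factors_through E (m \<cdot> w) (m \<cdot> k)"
      then obtain h where h: "(m \<cdot> k) \<cdot> h = m \<cdot> w" "h \<in> Arr E" "Dom E h = Dom E (m \<cdot> w)" "Cod E h = Dom E (m \<cdot> k)"
        by (rule factorsE)
      have "k \<cdot> h = w"
        by (rule monicD[OF mm]) (use h w mm k \<chi> in simp_all)
      then show "factors_through E w k"
        by (rule factorsI) (use h w mm k \<chi> in simp_all)
    next
      assume "factors_through E w k"
      then obtain h where h: "k \<cdot> h = w" "h \<in> Arr E" "Dom E h = Dom E w" "Cod E h = Dom E k"
        by (rule factorsE)
      then show "factors_through E (m \<cdot> w) (m \<cdot> k)"
        using w mm k \<chi> by (intro factorsI[of _ h]) simp_all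
    qed
    finally show "(\<psi> \<cdot> m) \<cdot> w = tru (Dom E w) \<longleftrightarrow> \<chi> \<cdot> w = tru (Dom E w)"
      using k(3)[OF w] w \<chi> \<psi> mm by simp
  qed (use \<psi> \<chi> mm in simp_all)
  \<comment> \<open>The classifier \<psi> need not be regular. Double negation makes it so, and over
    m it changes nothing because \<chi> is regular already.\<close>
  have "factors_through E (neg E \<cdot> (neg E \<cdot> \<psi>)) e"
    using e_iff[of "neg E \<cdot> (neg E \<cdot> \<psi>)"] neg_neg_neg[of "neg E \<cdot> \<psi>"] \<psi> by simp
  then obtain g where g: "e \<cdot> g = neg E \<cdot> (neg E \<cdot> \<psi>)" "g \<in> Arr E" "Dom E g = Dom E (neg E \<cdot> (neg E \<cdot> \<psi>))" "Cod E g = Dom E e"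
    by (rule factorsE)
  show "\<exists>!g. g \<in> Hom E (Cod E m) (Dom E e) \<and> g \<cdot> m = f"
  proof (rule ex1I[of _ g])
    have "e \<cdot> (g \<cdot> m) = (neg E \<cdot> (neg E \<cdot> \<psi>)) \<cdot> m"
      by (rule comp_reassoc[OF g(1)]) (use g e mm \<psi> in simp_all)
    then have "e \<cdot> (g \<cdot> m) = e \<cdot> f"
      using \<psi> mm \<open>\<psi> \<cdot> m = \<chi>\<close> \<chi>(4) by (simp add: \<chi>_def)
    then have gm: "g \<cdot> m = f"
      by (rule monicD[OF e(1)]) (use f g e mm \<psi> in simp_all)
    then show "g \<in> Hom E (Cod E m) (Dom E e) \<and> g \<cdot> m = f"
      using g \<psi> by simp
    fix g'
    assume g': "g' \<in> Hom E (Cod E m) (Dom E e) \<and> g' \<cdot> m = f"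
    have gt: "Dom E g = Cod E m"
      using g(3) \<psi> by simp
    have eq: "(e \<cdot> g') \<cdot> m = (e \<cdot> g) \<cdot> m"
      using g' g(2,4) gt gm e mm by simp
    have "e \<cdot> g' = e \<cdot> g"
    proof (rule Omega_ext)
      fix w
      assume "w \<in> Arr E" "Cod E w = Dom E (e \<cdot> g)"
      then have w: "w \<in> Arr E" "Cod E w = Cod E m"
        using g(2,4) gt e by simp_all
      show "(e \<cdot> g') \<cdot> w = tru (Dom E w) \<longleftrightarrow> (e \<cdot> g) \<cdot> w = tru (Dom E w)"
        using dense_implies[OF m _ _ _ _ _ _ _ eq w] dense_implies[OF m _ _ _ _ _ _ _ eq[symmetric] w]
          g' g(2,4) gt e reg[of g] reg[of g'] by auto
    qed (use g' g(2,4) gt e in simp_all)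
    then show "g' = g"
      by (rule monicD[OF e(1)]) (use g' g(2,4) gt e in simp_all)
  qed
qed

end

section \<open>The coproduct 1 + 1\<close>

locale pointed_topos = topos E for E :: "('o, 'a, 'm) topos_scheme" (structure) +
  assumes nondegenerate: "\<not> initial E (One E)"
    and NS: "NS E"
    and DSO: "DSO E"
begin

section \<open>Points of the subobject classifier\<close>

lemma point_ex:
  assumes "X \<in> Obj E" "\<not> initial E X"
  obtains x where "x \<in> Arr E" "Dom E x = One E" "Cod E x = X"
  using NS assms unfolding NS_def point_def by auto

lemma Tru_neq_Fls: "Tru E \<noteq> Fls E"
  using fal_eq_tru_iff[of "One E"] nondegenerate by (auto simp: fal_One tru_One)

text \<open>A truth value other than false holds at some non-initial stage v over 1. By NS that
  stage has a point x; the composite v \<cdot> x is the identity of 1, so the truth value holds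
  outright.\<close>

lemma point_Omega:
  assumes "\<omega> \<in> Arr E" "Dom E \<omega> = One E" "Cod E \<omega> = Omega E"
  shows "\<omega> = Tru E \<or> \<omega> = Fls E"
proof (cases "\<omega> = fal (Dom E \<omega>)")
  case True
  then show ?thesis
    using assms by (simp add: fal_One)
next
  case False
  then obtain v where v: "v \<in> Arr E" "Cod E v = One E" "\<omega> \<cdot> v = tru (Dom E v)" "\<not> initial E (Dom E v)"
    using eq_fal_iff[of \<omega>] assms by auto
  then obtain x where x: "x \<in> Arr E" "Dom E x = One E" "Cod E x = Dom E v"
    using point_ex[of "Dom E v"] by auto
  have "v \<cdot> x = Idn E (One E)"
    by (rule Arr_One_unique) (use x v in auto)
  moreover have "\<omega> \<cdot> (v \<cdot> x) = Tru E"
    using comp_reassoc[OF v(3), of x] v x assms by (simp add: tru_One)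
  ultimately show ?thesis
    using assms by simp
qed

lemma factors_point:
  assumes "x \<in> Arr E" "Dom E x = One E" "w \<in> Arr E" "Cod E w = Cod E x"
  shows "factors_through E w x \<longleftrightarrow> w = x \<cdot> bang E (Dom E w)"
proof
  assume "factors_through E w x"
  then obtain h where h: "x \<cdot> h = w" "h \<in> Arr E" "Dom E h = Dom E w" "Cod E h = Dom E x"
    by (rule factorsE)
  moreover have "h = bang E (Dom E w)"
    by (rule Arr_One_unique) (use h assms in auto)
  ultimately show "w = x \<cdot> bang E (Dom E w)"
    by simp
next
  assume *: "w = x \<cdot> bang E (Dom E w)"
  show "factors_through E w x"
    by (rule factorsI[OF *[symmetric]]) (use assms in auto)
qed

section \<open>The decidable subobject of points of Omega\<close>

definition incl :: 'a where
  "incl = (SOME \<gamma>. decidable_subobject_of_points E (Omega E) \<gamma> \<and>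
     (\<forall>m. decidable_subobject_of_points E (Omega E) m \<longrightarrow> factors_through E m \<gamma> \<and> factors_through E \<gamma> m))"

definition Two :: 'o where
  "Two = Dom E incl"

text \<open>Keeping the uniqueness clause of DSO inside the choice yields minimality:
  \<open>incl\<close> lies below every decidable subobject containing the points.\<close>

lemma incl_props:
  "decidable_subobject_of_points E (Omega E) incl"
  "decidable_subobject_of_points E (Omega E) m \<Longrightarrow> factors_through E incl m"
proof -
  have "\<exists>\<gamma>. decidable_subobject_of_points E (Omega E) \<gamma> \<and>
     (\<forall>m. decidable_subobject_of_points E (Omega E) m \<longrightarrow> factors_through E m \<gamma> \<and> factors_through E \<gamma> m)"
    using DSO Omega_Obj unfolding DSO_def by blast
  from someI_ex[OF this, folded incl_def]
  show "decidable_subobject_of_points E (Omega E) incl"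
    "decidable_subobject_of_points E (Omega E) m \<Longrightarrow> factors_through E incl m"
    by auto
qed

lemma monic_incl: "monic E incl"
  using incl_props(1) by (simp add: decidable_subobject_of_points_def subobject_def)

lemma incl_in_Arr [simp]: "incl \<in> Arr E" "Dom E incl = Two" "Cod E incl = Omega E"
  using incl_props(1) by (simp_all add: decidable_subobject_of_points_def subobject_def Two_def)

lemma Two_Obj [simp]: "Two \<in> Obj E"
  using Dom_in_Obj[OF incl_in_Arr(1)] by simp

lemma factors_incl:
  assumes "x \<in> Arr E" "Dom E x = One E" "Cod E x = Omega E"
  shows "factors_through E x incl"
  using incl_props(1) assms by (simp add: decidable_subobject_of_points_def point_def)

definition yes :: 'a where
  "yes = (SOME h. incl \<cdot> h = Tru E \<and> h \<in> Arr E \<and> Dom E h = One E \<and> Cod E h = Two)"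

definition no :: 'a where
  "no = (SOME h. incl \<cdot> h = Fls E \<and> h \<in> Arr E \<and> Dom E h = One E \<and> Cod E h = Two)"

lemma yes_in_Arr [simp]: "incl \<cdot> yes = Tru E" "yes \<in> Arr E" "Dom E yes = One E" "Cod E yes = Two"
proof -
  have "\<exists>h. incl \<cdot> h = Tru E \<and> h \<in> Arr E \<and> Dom E h = One E \<and> Cod E h = Two"
    using factors_incl[of "Tru E"] by (auto elim!: factorsE)
  from someI_ex[OF this, folded yes_def]
  show "incl \<cdot> yes = Tru E" "yes \<in> Arr E" "Dom E yes = One E" "Cod E yes = Two"
    by auto
qed

lemma no_in_Arr [simp]: "incl \<cdot> no = Fls E" "no \<in> Arr E" "Dom E no = One E" "Cod E no = Two"
proof -
  have "\<exists>h. incl \<cdot> h = Fls E \<and> h \<in> Arr E \<and> Dom E h = One E \<and> Cod E h = Two"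
    using factors_incl[of "Fls E"] by (auto elim!: factorsE)
  from someI_ex[OF this, folded no_def]
  show "incl \<cdot> no = Fls E" "no \<in> Arr E" "Dom E no = One E" "Cod E no = Two"
    by auto
qed

lemma incl_yes_no [simp]:
  assumes "X \<in> Obj E"
  shows "incl \<cdot> (yes \<cdot> bang E X) = tru X" "incl \<cdot> (no \<cdot> bang E X) = fal X"
  using comp_reassoc[OF yes_in_Arr(1), of "bang E X"] comp_reassoc[OF no_in_Arr(1), of "bang E X"] assms
  by (simp_all add: tru_def fal_def)

lemma yes_neq_no: "yes \<noteq> no"
  using Tru_neq_Fls yes_in_Arr(1) no_in_Arr(1) by metis

text \<open>
  A subobject of \<open>Two\<close> containing both points is again a decidable subobject of \<open>Omega E\<close>
  containing all points, so uniqueness in DSO makes it everything.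
\<close>

lemma covers_Two: "covers Two yes no"
  unfolding covers_def
proof (intro conjI allI impI, simp_all, elim conjE)
  fix k
  assume k: "monic E k" "Cod E k = Two" "factors_through E yes k" "factors_through E no k"
  have "decidable_subobject_of_points E (Omega E) (incl \<cdot> k)"
    unfolding decidable_subobject_of_points_def subobject_def
  proof (intro conjI allI impI)
    show "monic E (incl \<cdot> k)"
      using monic_comp[OF monic_incl k(1)] k by simp
    show "decidable E (Dom E (incl \<cdot> k))"
      using decidable_subobject[OF k(1)] incl_props(1) k
      by (simp add: decidable_subobject_of_points_def)
    fix x
    assume x: "point E (Omega E) x"
    have "factors_through E (incl \<cdot> y) (incl \<cdot> k)"
      if y: "factors_through E y k" "y \<in> Arr E" "Cod E y = Two" for y
    proof -
      obtain h where h: "k \<cdot> h = y" "h \<in> Arr E" "Dom E h = Dom E y" "Cod E h = Dom E k"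
        using y(1) by (rule factorsE)
      then show ?thesis
        using y k by (intro factorsI[of _ h]) auto
    qed
    from this[of yes] this[of no] show "factors_through E x (incl \<cdot> k)"
      using point_Omega[of x] x k by (auto simp: point_def)
  qed (use k in simp)
  then have "factors_through E incl (incl \<cdot> k)"
    by (rule incl_props)
  then obtain h where h: "(incl \<cdot> k) \<cdot> h = incl" "h \<in> Arr E" "Dom E h = Dom E incl" "Cod E h = Dom E (incl \<cdot> k)"
    by (rule factorsE)
  have "k \<cdot> h = Idn E Two"
    by (rule monicD[OF monic_incl]) (use h k in simp_all)
  then show "factors_through E (Idn E Two) k"
    using h k by (intro factorsI[of k h]) simp_all
qed

text \<open>Internal case distinction on c: the cover of \<open>Two\<close> by its two points,
  pulled back along c.\<close>

lemma Two_cases: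
  assumes "c \<in> Arr E" "Cod E c = Two" "monic E k" "Cod E k = Dom E c"
    and "\<And>w. w \<in> Arr E \<Longrightarrow> Cod E w = Dom E c \<Longrightarrow> c \<cdot> w = yes \<cdot> bang E (Dom E w) \<Longrightarrow> factors_through E w k"
    and "\<And>w. w \<in> Arr E \<Longrightarrow> Cod E w = Dom E c \<Longrightarrow> c \<cdot> w = no \<cdot> bang E (Dom E w) \<Longrightarrow> factors_through E w k"
  shows "factors_through E (Idn E (Dom E c)) k"
  by (rule covers_stable[of c yes no]) (use assms covers_Two factors_point in simp_all)

lemma eq_by_Two_cases:
  assumes "c \<in> Arr E" "Cod E c = Two"
    and fg: "f \<in> Arr E" "g \<in> Arr E" "Dom E f = Dom E c" "Dom E g = Dom E c" "Cod E f = Cod E g"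
    and "\<And>w. w \<in> Arr E \<Longrightarrow> Cod E w = Dom E c \<Longrightarrow> c \<cdot> w = yes \<cdot> bang E (Dom E w) \<Longrightarrow> f \<cdot> w = g \<cdot> w"
    and "\<And>w. w \<in> Arr E \<Longrightarrow> Cod E w = Dom E c \<Longrightarrow> c \<cdot> w = no \<cdot> bang E (Dom E w) \<Longrightarrow> f \<cdot> w = g \<cdot> w"
  shows "f = g"
proof -
  obtain e where e: "monic E e" "Cod E e = Dom E f"
    "\<And>w. w \<in> Arr E \<Longrightarrow> Cod E w = Dom E f \<Longrightarrow> factors_through E w e \<longleftrightarrow> f \<cdot> w = g \<cdot> w"
    using equalizer_ex[of f g] fg by auto
  have "factors_through E (Idn E (Dom E c)) e"
    by (rule Two_cases) (use assms e in simp_all)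
  then show ?thesis
    using e(3)[of "Idn E (Dom E c)"] fg assms(1) by simp
qed

text \<open>Points decide here. A non-initial stage at which c is \<open>no\<close> would have a
  point by NS, contrary to the assumption; over an initial stage any two parallel arrows
  agree.\<close>

lemma constant_yes:
  assumes "c \<in> Arr E" "Cod E c = Two"
    and pts: "\<And>x. x \<in> Arr E \<Longrightarrow> Dom E x = One E \<Longrightarrow> Cod E x = Dom E c \<Longrightarrow> c \<cdot> x = yes"
  shows "c = yes \<cdot> bang E (Dom E c)"
proof (rule eq_by_Two_cases[of c])
  fix w
  assume w: "w \<in> Arr E" "Cod E w = Dom E c" "c \<cdot> w = no \<cdot> bang E (Dom E w)"
  have "initial E (Dom E w)"
  proof (rule ccontr)
    assume "\<not> initial E (Dom E w)"
    then obtain x where x: "x \<in> Arr E" "Dom E x = One E" "Cod E x = Dom E w"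
      using point_ex[of "Dom E w"] w by auto
    have "c \<cdot> (w \<cdot> x) = no"
      using comp_reassoc[OF w(3), of x] w x assms(1) by simp
    then show False
      using pts[of "w \<cdot> x"] w x yes_neq_no by simp
  qed
  then show "c \<cdot> w = (yes \<cdot> bang E (Dom E c)) \<cdot> w"
    by (rule initialD) (use assms w in simp_all)
qed (use assms in simp_all)

text \<open>The characteristic arrow d of the diagonal is true on the diagonal and false on its
  complement. Both values lie in \<open>incl\<close> and the two parts cover, so d factors through
  \<open>Two\<close>.\<close>

lemma equality_test:
  assumes D: "decidable E D"
  obtains \<delta> where "\<delta> \<in> Arr E" "Dom E \<delta> = Prod E D D" "Cod E \<delta> = Two"
    "\<And>x y. x \<in> Arr E \<Longrightarrow> y \<in> Arr E \<Longrightarrow> Dom E x = Dom E y \<Longrightarrow> Cod E x = D \<Longrightarrow> Cod E y = D \<Longrightarrow>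
      \<delta> \<cdot> pair E x y = yes \<cdot> bang E (Dom E y) \<longleftrightarrow> x = y"
proof -
  have DO: "D \<in> Obj E"
    using D by (simp add: decidable_def)
  define d where "d = classifier E (diag D)"
  have d: "d \<in> Arr E" "Dom E d = Prod E D D" "Cod E d = Omega E"
    using DO by (simp_all add: d_def)
  have d_tru: "d \<cdot> w = tru (Dom E w) \<longleftrightarrow> factors_through E w (diag D)"
    if "w \<in> Arr E" "Cod E w = Prod E D D" for w
    using classifier_iff[of "diag D" w] that DO by (simp add: d_def)
  obtain n where n: "monic E n" "Cod E n = Prod E D D" "covers (Prod E D D) (diag D) n"
    and disj: "\<And>w. w \<in> Arr E \<Longrightarrow> Cod E w = Prod E D D \<Longrightarrow> factors_through E w (diag D) \<Longrightarrow> factors_through E w n \<Longrightarrow>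
      initial E (Dom E w)"
    using decidable_complement[OF D] by blast
  \<comment> \<open>The predicate that the truth value d lies in \<open>incl\<close>; its extent k
    is to be shown to contain both halves of the cover.\<close>
  define \<chi> where "\<chi> = classifier E incl \<cdot> d"
  have \<chi>: "\<chi> \<in> Arr E" "Dom E \<chi> = Prod E D D" "Cod E \<chi> = Omega E"
    using d monic_incl by (simp_all add: \<chi>_def)
  obtain k where k: "monic E k" "Cod E k = Prod E D D"
    "\<And>w. w \<in> Arr E \<Longrightarrow> Cod E w = Prod E D D \<Longrightarrow> factors_through E w k \<longleftrightarrow> \<chi> \<cdot> w = tru (Dom E w)"
    using subobject_of_predicate[OF \<chi>(1,3)] \<chi>(2) by auto
  have fk: "factors_through E w k \<longleftrightarrow> factors_through E (d \<cdot> w) incl"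
    if "w \<in> Arr E" "Cod E w = Prod E D D" for w
    using k(3)[OF that] classifier_iff[OF monic_incl, of "d \<cdot> w"] that d monic_incl by (simp add: \<chi>_def)
  have "factors_through E (diag D) k"
  proof -
    have "d \<cdot> diag D = tru D"
      using d_tru[of "diag D"] factors_self[of "diag D"] DO by simp
    moreover have "factors_through E (tru D) incl"
      by (rule factorsI[of _ "yes \<cdot> bang E D"]) (use DO in simp_all)
    ultimately show ?thesis
      using fk[of "diag D"] DO by simp
  qed
  moreover have "factors_through E n k"
  proof -
    have "d \<cdot> n = fal (Dom E (d \<cdot> n))"
    proof (subst eq_fal_iff, simp_all add: d n, intro allI impI, elim conjE)
      fix v
      assume v: "v \<in> Arr E" "Cod E v = Dom E n" "(d \<cdot> n) \<cdot> v = tru (Dom E v)"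
      have "initial E (Dom E (n \<cdot> v))"
      proof (rule disj)
        show "factors_through E (n \<cdot> v) (diag D)"
          using d_tru[of "n \<cdot> v"] v n d by simp
        show "factors_through E (n \<cdot> v) n"
          by (rule factorsI[of n v]) (use v n in simp_all)
      qed (use v n in simp_all)
      then show "initial E (Dom E v)"
        using v n by simp
    qed
    then have "d \<cdot> n = fal (Dom E n)"
      using d n by simp
    moreover have "factors_through E (fal (Dom E n)) incl"
      by (rule factorsI[of _ "no \<cdot> bang E (Dom E n)"]) (use n in simp_all)
    ultimately show ?thesis
      using fk[of n] n by simp
  qed
  ultimately have "factors_through E (Idn E (Prod E D D)) k"
    using n(3) k(1,2) unfolding covers_def by blast
  then have "factors_through E d incl"
    using fk[of "Idn E (Prod E D D)"] DO d by simp
  then obtain \<delta> where \<delta>: "incl \<cdot> \<delta> = d" "\<delta> \<in> Arr E" "Dom E \<delta> = Dom E d" "Cod E \<delta> = Dom E incl"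
    by (rule factorsE)
  have "\<delta> \<cdot> pair E x y = yes \<cdot> bang E (Dom E y) \<longleftrightarrow> x = y"
    if xy: "x \<in> Arr E" "y \<in> Arr E" "Dom E x = Dom E y" "Cod E x = D" "Cod E y = D" for x y
  proof -
    have "\<delta> \<cdot> pair E x y = yes \<cdot> bang E (Dom E y) \<longleftrightarrow> incl \<cdot> (\<delta> \<cdot> pair E x y) = incl \<cdot> (yes \<cdot> bang E (Dom E y))"
      using monicD[OF monic_incl, of "\<delta> \<cdot> pair E x y" "yes \<cdot> bang E (Dom E y)"] \<delta> d xy by auto
    also have "incl \<cdot> (\<delta> \<cdot> pair E x y) = d \<cdot> pair E x y"
      by (rule comp_reassoc) (use \<delta> d xy in simp_all)
    finally show ?thesis
      using classifier_diag[OF xy] xy by (simp add: d_def)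
  qed
  then show thesis
    using that \<delta> d by simp
qed

section \<open>Arrows out of Two\<close>

lemma neg_Tru: "neg E \<cdot> Tru E = Fls E"
proof -
  have "neg E \<cdot> Tru E \<noteq> Tru E"
    using neg_eq_tru_iff[of "Tru E"] Tru_neq_Fls by (auto simp: tru_One fal_One)
  then show ?thesis
    using point_Omega[of "neg E \<cdot> Tru E"] by simp
qed

lemma neg_Fls: "neg E \<cdot> Fls E = Tru E"
  using neg_fal[of "One E"] by (simp add: tru_One fal_One)

text \<open>
  The arrow out of \<open>Two\<close> with prescribed values \<open>f\<close> and \<open>g\<close> is obtained from its graph, the
  subobject of pairs \<open>(\<omega>, z)\<close> such that \<open>\<omega> = yes\<close> is equivalent to \<open>(\<omega>, z) = (yes, f)\<close> and
  \<open>\<omega> = no\<close> is equivalent to \<open>(\<omega>, z) = (no, g)\<close>.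
\<close>

lemma Two_copair:
  assumes f: "f \<in> Arr E" "Dom E f = One E" "Cod E f = Z"
    and g: "g \<in> Arr E" "Dom E g = One E" "Cod E g = Z"
  obtains h where "h \<in> Arr E" "Dom E h = Two" "Cod E h = Z" "h \<cdot> yes = f" "h \<cdot> no = g"
proof -
  have Z: "Z \<in> Obj E"
    using f by auto
  let ?P = "Prod E Two Z" and ?\<Omega> = "Omega E"
  define a b where "a = classifier E (pair E yes f)" and "b = classifier E (pair E no g)"
  have ma: "monic E (pair E yes f)" and mb: "monic E (pair E no g)"
    using f g by (auto intro: monic_point)
  have ta: "a \<in> Arr E" "Dom E a = ?P" "Cod E a = ?\<Omega>" and tb: "b \<in> Arr E" "Dom E b = ?P" "Cod E b = ?\<Omega>"
    using f g ma mb by (simp_all add: a_def b_def)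
  have a_iff: "a \<cdot> w = tru (Dom E w) \<longleftrightarrow> w = pair E yes f \<cdot> bang E (Dom E w)"
    if "w \<in> Arr E" "Cod E w = ?P" for w
    using classifier_iff[OF ma, of w] factors_point[of "pair E yes f" w] that f by (simp add: a_def)
  have b_iff: "b \<cdot> w = tru (Dom E w) \<longleftrightarrow> w = pair E no g \<cdot> bang E (Dom E w)"
    if "w \<in> Arr E" "Cod E w = ?P" for w
    using classifier_iff[OF mb, of w] factors_point[of "pair E no g" w] that g by (simp add: b_def)
  have neq: "pair E yes f \<noteq> pair E no g"
    using pair_inject(1)[of yes f no g] yes_neq_no f g by auto
  let ?s = "incl \<cdot> Pr1 E Two Z"
  obtain r where r: "monic E r" "Cod E r = ?P"
    "\<And>w. w \<in> Arr E \<Longrightarrow> Cod E w = ?P \<Longrightarrow> factors_through E w r \<longleftrightarrow>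
      pair E ?s (neg E \<cdot> ?s) \<cdot> w = pair E a b \<cdot> w"
    using equalizer_ex[of "pair E ?s (neg E \<cdot> ?s)" "pair E a b"] Z ta tb by auto
  have fr: "factors_through E w r \<longleftrightarrow>
      pair E (incl \<cdot> (Pr1 E Two Z \<cdot> w)) (neg E \<cdot> (incl \<cdot> (Pr1 E Two Z \<cdot> w))) = pair E (a \<cdot> w) (b \<cdot> w)"
    if "w \<in> Arr E" "Cod E w = ?P" for w
    using r(3)[OF that] that Z ta tb by simp
  have yr: "factors_through E (pair E yes f) r"
  proof -
    have "a \<cdot> pair E yes f = Tru E"
      using a_iff[of "pair E yes f"] f by (simp add: tru_One)
    moreover have "b \<cdot> pair E yes f = Fls E"
      using b_iff[of "pair E yes f"] point_Omega[of "b \<cdot> pair E yes f"] neq f g tb by (simp add: tru_One)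
    ultimately show ?thesis
      using fr[of "pair E yes f"] f by (simp add: neg_Tru)
  qed
  have nr: "factors_through E (pair E no g) r"
  proof -
    have "b \<cdot> pair E no g = Tru E"
      using b_iff[of "pair E no g"] g by (simp add: tru_One)
    moreover have "a \<cdot> pair E no g = Fls E"
      using a_iff[of "pair E no g"] point_Omega[of "a \<cdot> pair E no g"] neq f g ta by (simp add: tru_One)
    ultimately show ?thesis
      using fr[of "pair E no g"] g by (simp add: neg_Fls)
  qed
  have value_yes: "pair E (yes \<cdot> bang E (Dom E w)) z = pair E yes f \<cdot> bang E (Dom E w)"
    if w: "w \<in> Arr E" "z \<in> Arr E" "Dom E z = Dom E w" "Cod E z = Z"
      "factors_through E (pair E (yes \<cdot> bang E (Dom E w)) z) r" for w z
  proof -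
    let ?v = "pair E (yes \<cdot> bang E (Dom E w)) z"
    have "pair E (tru (Dom E w)) (neg E \<cdot> tru (Dom E w)) = pair E (a \<cdot> ?v) (b \<cdot> ?v)"
      using fr[of ?v] w by simp
    then have "tru (Dom E w) = a \<cdot> ?v"
      by (rule pair_inject(1)) (use w ta tb in simp_all)
    then show ?thesis
      using a_iff[of ?v] w by simp
  qed
  have value_no: "pair E (no \<cdot> bang E (Dom E w)) z = pair E no g \<cdot> bang E (Dom E w)"
    if w: "w \<in> Arr E" "z \<in> Arr E" "Dom E z = Dom E w" "Cod E z = Z"
      "factors_through E (pair E (no \<cdot> bang E (Dom E w)) z) r" for w z
  proof -
    let ?v = "pair E (no \<cdot> bang E (Dom E w)) z"
    have "pair E (fal (Dom E w)) (tru (Dom E w)) = pair E (a \<cdot> ?v) (b \<cdot> ?v)"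
      using fr[of ?v] w by simp
    then have "tru (Dom E w) = b \<cdot> ?v"
      by (rule pair_inject(2)) (use w ta tb in simp_all)
    then show ?thesis
      using b_iff[of ?v] w by simp
  qed
  define q where "q = Pr1 E Two Z \<cdot> r"
  have q: "q \<in> Arr E" "Dom E q = Dom E r" "Cod E q = Two"
    using r Z by (simp_all add: q_def)
  have "monic E q"
  proof (rule monicI)
    fix u v
    assume *: "u \<in> Arr E" "v \<in> Arr E" "Dom E u = Dom E v" "Cod E u = Dom E q" "Cod E v = Dom E q" "q \<cdot> u = q \<cdot> v"
    have eta: "r \<cdot> t = pair E (q \<cdot> t) (Pr2 E Two Z \<cdot> (r \<cdot> t))" "factors_through E (r \<cdot> t) r"
      if t: "t \<in> Arr E" "Cod E t = Dom E r" for t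
      using pair_eta[of "r \<cdot> t" Two Z] factorsI[of r t "r \<cdot> t"] t r Z by (simp_all add: q_def)
    show "u = v"
    proof (rule eq_by_Two_cases[of "q \<cdot> u"])
      fix w
      assume w: "w \<in> Arr E" "Cod E w = Dom E (q \<cdot> u)" "(q \<cdot> u) \<cdot> w = yes \<cdot> bang E (Dom E w)"
      then have w': "Cod E w = Dom E v" "q \<cdot> (u \<cdot> w) = yes \<cdot> bang E (Dom E w)" "q \<cdot> (v \<cdot> w) = yes \<cdot> bang E (Dom E w)"
        using * q comp_reassoc[OF *(6), of w] by simp_all
      have "r \<cdot> t = pair E yes f \<cdot> bang E (Dom E w)"
        if t: "t \<in> Arr E" "Cod E t = Dom E r" "Dom E t = Dom E w" "q \<cdot> t = yes \<cdot> bang E (Dom E w)" for t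
      proof -
        have "pair E (yes \<cdot> bang E (Dom E w)) (Pr2 E Two Z \<cdot> (r \<cdot> t)) = pair E yes f \<cdot> bang E (Dom E w)"
          by (rule value_yes) (use t w r Z eta[OF t(1,2)] in simp_all)
        then show ?thesis
          using eta[OF t(1,2)] t by simp
      qed
      then have "r \<cdot> (u \<cdot> w) = r \<cdot> (v \<cdot> w)"
        using w w' * q by simp
      then show "u \<cdot> w = v \<cdot> w"
        by (rule monicD[OF r(1)]) (use w w' * q in simp_all)
    next
      fix w
      assume w: "w \<in> Arr E" "Cod E w = Dom E (q \<cdot> u)" "(q \<cdot> u) \<cdot> w = no \<cdot> bang E (Dom E w)"
      then have w': "Cod E w = Dom E v" "q \<cdot> (u \<cdot> w) = no \<cdot> bang E (Dom E w)" "q \<cdot> (v \<cdot> w) = no \<cdot> bang E (Dom E w)"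
        using * q comp_reassoc[OF *(6), of w] by simp_all
      have "r \<cdot> t = pair E no g \<cdot> bang E (Dom E w)"
        if t: "t \<in> Arr E" "Cod E t = Dom E r" "Dom E t = Dom E w" "q \<cdot> t = no \<cdot> bang E (Dom E w)" for t
      proof -
        have "pair E (no \<cdot> bang E (Dom E w)) (Pr2 E Two Z \<cdot> (r \<cdot> t)) = pair E no g \<cdot> bang E (Dom E w)"
          by (rule value_no) (use t w r Z eta[OF t(1,2)] in simp_all)
        then show ?thesis
          using eta[OF t(1,2)] t by simp
      qed
      then have "r \<cdot> (u \<cdot> w) = r \<cdot> (v \<cdot> w)"
        using w w' * q by simp
      then show "u \<cdot> w = v \<cdot> w"
        by (rule monicD[OF r(1)]) (use w w' * q in simp_all)
    qed (use * q in simp_all)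
  qed (fact q)
  obtain sy where sy: "r \<cdot> sy = pair E yes f" "sy \<in> Arr E" "Dom E sy = Dom E (pair E yes f)" "Cod E sy = Dom E r"
    using yr by (rule factorsE)
  obtain sn where sn: "r \<cdot> sn = pair E no g" "sn \<in> Arr E" "Dom E sn = Dom E (pair E no g)" "Cod E sn = Dom E r"
    using nr by (rule factorsE)
  have qy: "q \<cdot> sy = yes" and qn: "q \<cdot> sn = no"
    using sy sn r Z f g by (simp_all add: q_def)
  have "factors_through E (Idn E Two) q"
  proof -
    have "factors_through E yes q" "factors_through E no q"
      by (rule factorsI[OF qy], use sy sn f g q in simp_all, rule factorsI[OF qn], use sy sn f g q in simp_all)
    then show ?thesis
      using covers_Two \<open>monic E q\<close> q unfolding covers_def by blast
  qed
  then obtain t where t: "q \<cdot> t = Idn E Two" "t \<in> Arr E" "Dom E t = Dom E (Idn E Two)" "Cod E t = Dom E q"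
    by (rule factorsE)
  have ty: "t \<cdot> yes = sy"
  proof (rule monicD[OF \<open>monic E q\<close>])
    show "q \<cdot> (t \<cdot> yes) = q \<cdot> sy"
      using comp_reassoc[OF t(1), of yes] t q qy by simp
  qed (use t sy q f in simp_all)
  have tn: "t \<cdot> no = sn"
  proof (rule monicD[OF \<open>monic E q\<close>])
    show "q \<cdot> (t \<cdot> no) = q \<cdot> sn"
      using comp_reassoc[OF t(1), of no] t q qn by simp
  qed (use t sn q g in simp_all)
  show thesis
  proof
    show "(Pr2 E Two Z \<cdot> (r \<cdot> t)) \<cdot> yes = f" "(Pr2 E Two Z \<cdot> (r \<cdot> t)) \<cdot> no = g"
      using ty tn sy sn t r q Z f g by simp_all
  qed (use t r q Z in simp_all)
qed

text \<open>Minimality of decidable objects quantifies over presentations of 1 + 1; this one makes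
  the universal property of \<open>p\<close> usable with target \<open>Two\<close>.\<close>

lemma coproduct_Two: "coproduct E (One E) (One E) Two yes no"
  unfolding coproduct_def
proof (intro conjI ballI)
  fix Z f g
  assume *: "Z \<in> Obj E" "f \<in> Hom E (One E) Z" "g \<in> Hom E (One E) Z"
  obtain h where h: "h \<in> Arr E" "Dom E h = Two" "Cod E h = Z" "h \<cdot> yes = f" "h \<cdot> no = g"
    using Two_copair[of f Z g] * by auto
  show "\<exists>!h. h \<in> Hom E Two Z \<and> h \<cdot> yes = f \<and> h \<cdot> no = g"
  proof (rule ex1I[of _ h])
    fix k
    assume k: "k \<in> Hom E Two Z \<and> k \<cdot> yes = f \<and> k \<cdot> no = g"
    show "k = h"
    proof (rule eq_by_Two_cases[of "Idn E Two"])
      fix w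
      assume w: "w \<in> Arr E" "Cod E w = Dom E (Idn E Two)"
      have kh: "k \<cdot> (yes \<cdot> bang E (Dom E w)) = h \<cdot> (yes \<cdot> bang E (Dom E w))"
        "k \<cdot> (no \<cdot> bang E (Dom E w)) = h \<cdot> (no \<cdot> bang E (Dom E w))"
        using comp_reassoc[of k yes "f" "bang E (Dom E w)"] comp_reassoc[of h yes "f" "bang E (Dom E w)"]
          comp_reassoc[of k no "g" "bang E (Dom E w)"] comp_reassoc[of h no "g" "bang E (Dom E w)"] k h w
        by simp_all
      show "k \<cdot> w = h \<cdot> w" if "Idn E Two \<cdot> w = yes \<cdot> bang E (Dom E w)"
        using that kh w by simp
      show "k \<cdot> w = h \<cdot> w" if "Idn E Two \<cdot> w = no \<cdot> bang E (Dom E w)"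
        using that kh w by simp
    qed (use h k in simp_all)
  qed (use h in simp)
qed simp_all

end

section \<open>Connectedness\<close>

locale homotopy_topos = pointed_topos E for E :: "('o, 'a, 'm) topos_scheme" (structure) +
  fixes \<Pi> :: "'o \<Rightarrow> 'o" and p :: "'o \<Rightarrow> 'a"
  assumes homotopy: "homotopy_theory E \<Pi> p"
begin

lemma p_props:
  assumes "X \<in> Obj E"
  shows "decidable E (\<Pi> X)" "p X \<in> Arr E" "Dom E (p X) = X" "Cod E (p X) = \<Pi> X" "\<Pi> X \<in> Obj E"
    and "c \<in> Arr E \<Longrightarrow> Dom E c = X \<Longrightarrow> Cod E c = Two \<Longrightarrow> \<exists>!g. g \<in> Hom E (\<Pi> X) Two \<and> g \<cdot> p X = c"
proof -
  have m: "minimal_decidable E X (\<Pi> X) (p X)"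
    using homotopy assms by (simp add: homotopy_theory_def)
  then show "decidable E (\<Pi> X)" and *: "p X \<in> Arr E" "Dom E (p X) = X" "Cod E (p X) = \<Pi> X"
    by (simp_all add: minimal_decidable_def)
  then show "\<Pi> X \<in> Obj E"
    using Cod_in_Obj[of "p X"] by simp
  show "\<exists>!g. g \<in> Hom E (\<Pi> X) Two \<and> g \<cdot> p X = c" if "c \<in> Arr E" "Dom E c = X" "Cod E c = Two"
  proof -
    have "\<forall>f\<in>Hom E X Two. \<exists>!g. g \<in> Hom E (\<Pi> X) Two \<and> g \<cdot> p X = f"
      using m coproduct_Two unfolding minimal_decidable_def by blast
    then show ?thesis
      using that by simp
  qed
qed

section \<open>Points not separated by arrows into 1 + 1\<close>

definition indist :: "'a \<Rightarrow> 'a \<Rightarrow> bool" where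
  "indist x y \<longleftrightarrow> x \<in> Hom E (One E) (Cod E x) \<and> y \<in> Hom E (One E) (Cod E x) \<and>
    (\<forall>c \<in> Hom E (Cod E x) Two. c \<cdot> x = c \<cdot> y)"

lemma indist_refl: "x \<in> Arr E \<Longrightarrow> Dom E x = One E \<Longrightarrow> indist x x"
  by (simp add: indist_def)

lemma indist_sym: "indist x y \<Longrightarrow> indist y x"
  by (simp add: indist_def)

lemma indist_trans: "indist x y \<Longrightarrow> indist y z \<Longrightarrow> indist x z"
  by (simp add: indist_def)

lemma indist_image:
  assumes "indist x y" "f \<in> Arr E" "Dom E f = Cod E x"
  shows "indist (f \<cdot> x) (f \<cdot> y)"
  unfolding indist_def
proof (intro conjI ballI)
  fix c
  assume c: "c \<in> Hom E (Cod E (f \<cdot> x)) Two"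
  have xy: "x \<in> Arr E" "y \<in> Arr E" "Cod E y = Cod E x"
    using assms(1) by (simp_all add: indist_def)
  have "(c \<cdot> f) \<cdot> x = (c \<cdot> f) \<cdot> y"
    using assms c unfolding indist_def by simp
  then show "c \<cdot> (f \<cdot> x) = c \<cdot> (f \<cdot> y)"
    using xy c assms by simp
qed (use assms in \<open>simp_all add: indist_def\<close>)

text \<open>Every test on X factors through \<open>p X\<close>, so points identified by
  \<open>p X\<close> pass the same tests. Conversely, asking in the decidable object
  \<open>\<Pi> X\<close> for equality with the image of x is itself a test on X; it answers
  \<open>yes\<close> at x, hence also at y.\<close>

lemma p_eq_iff:
  assumes "x \<in> Arr E" "y \<in> Arr E" "Dom E x = One E" "Dom E y = One E" "Cod E x = X" "Cod E y = X"
  shows "p X \<cdot> x = p X \<cdot> y \<longleftrightarrow> indist x y"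
proof
  have X: "X \<in> Obj E"
    using assms by auto
  note P = p_props(1-5)[OF X]
  {
    assume eq: "p X \<cdot> x = p X \<cdot> y"
    show "indist x y"
      unfolding indist_def
    proof (intro conjI ballI)
      fix c
      assume c: "c \<in> Hom E (Cod E x) Two"
      then obtain g where g: "g \<in> Arr E" "Dom E g = \<Pi> X" "Cod E g = Two" "g \<cdot> p X = c"
        using p_props(6)[OF X, of c] assms by auto
      have "g \<cdot> (p X \<cdot> x) = c \<cdot> x" "g \<cdot> (p X \<cdot> y) = c \<cdot> y"
        by (rule comp_reassoc[OF g(4)]; use g P assms in simp)+
      then show "c \<cdot> x = c \<cdot> y"
        using eq by simp
    qed (use assms in simp_all)
  next
    assume ind: "indist x y"
    obtain \<delta> where \<delta>: "\<delta> \<in> Arr E" "Dom E \<delta> = Prod E (\<Pi> X) (\<Pi> X)" "Cod E \<delta> = Two"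
      "\<And>x y. x \<in> Arr E \<Longrightarrow> y \<in> Arr E \<Longrightarrow> Dom E x = Dom E y \<Longrightarrow> Cod E x = \<Pi> X \<Longrightarrow> Cod E y = \<Pi> X \<Longrightarrow>
        \<delta> \<cdot> pair E x y = yes \<cdot> bang E (Dom E y) \<longleftrightarrow> x = y"
      using equality_test[OF P(1)] by blast
    \<comment> \<open>The test on X asking whether a point has the same image under
      \<open>p X\<close> as x.\<close>
    define c where "c = \<delta> \<cdot> pair E (p X \<cdot> (x \<cdot> bang E X)) (p X)"
    have c: "c \<cdot> z = \<delta> \<cdot> pair E (p X \<cdot> x) (p X \<cdot> z)"
      if "z \<in> Arr E" "Dom E z = One E" "Cod E z = X" for z
      using that \<delta>(1-3) P assms X by (simp add: c_def)
    have "c \<cdot> x = c \<cdot> y"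
      using ind \<delta>(1-3) P assms X unfolding indist_def c_def by simp
    then show "p X \<cdot> x = p X \<cdot> y"
      using c[of x] c[of y] \<delta>(4)[of "p X \<cdot> x" "p X \<cdot> x"] \<delta>(4)[of "p X \<cdot> x" "p X \<cdot> y"] P assms by simp
  }
qed

text \<open>When \<open>\<Pi> X\<close> is isomorphic to 1, it has only one point for
  \<open>p X\<close> to take as a value.\<close>

lemma connected_indist:
  assumes "is_connected E \<Pi> X"
    and "x \<in> Arr E" "y \<in> Arr E" "Dom E x = One E" "Dom E y = One E" "Cod E x = X" "Cod E y = X"
  shows "indist x y"
proof -
  have X: "X \<in> Obj E"
    using assms(1) by (simp add: is_connected_def)
  note P = p_props(1-5)[OF X]
  obtain i j where i: "i \<in> Hom E (\<Pi> X) (One E)" and j: "j \<in> Hom E (One E) (\<Pi> X)" "j \<cdot> i = Idn E (\<Pi> X)"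
    using assms(1) unfolding is_connected_def isomorphic_def by blast
  have "p X \<cdot> z = j" if z: "z \<in> Arr E" "Dom E z = One E" "Cod E z = X" for z
  proof -
    have "i \<cdot> (p X \<cdot> z) = Idn E (One E)"
      by (rule Arr_One_unique) (use i z P in simp_all)
    moreover have "j \<cdot> (i \<cdot> (p X \<cdot> z)) = Idn E (\<Pi> X) \<cdot> (p X \<cdot> z)"
      by (rule comp_reassoc[OF j(2)]) (use i j z P in simp_all)
    ultimately show ?thesis
      using z P j by simp
  qed
  then show ?thesis
    using p_eq_iff[of x y X] assms by simp
qed

text \<open>The point to prove is that the identity of \<open>\<Pi> X\<close> equals the constant
  arrow at the image of a. The equality test comparing them answers \<open>yes\<close> at the image
  of every point of X, so after \<open>p X\<close> it is constant by NS.\<close>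

lemma connectedI:
  assumes a: "a \<in> Arr E" "Dom E a = One E" "Cod E a = X"
    and ind: "\<And>x. x \<in> Arr E \<Longrightarrow> Dom E x = One E \<Longrightarrow> Cod E x = X \<Longrightarrow> indist a x"
  shows "is_connected E \<Pi> X"
proof -
  have X: "X \<in> Obj E"
    using a by auto
  note P = p_props(1-5)[OF X]
  obtain \<delta> where \<delta>: "\<delta> \<in> Arr E" "Dom E \<delta> = Prod E (\<Pi> X) (\<Pi> X)" "Cod E \<delta> = Two"
    "\<And>x y. x \<in> Arr E \<Longrightarrow> y \<in> Arr E \<Longrightarrow> Dom E x = Dom E y \<Longrightarrow> Cod E x = \<Pi> X \<Longrightarrow> Cod E y = \<Pi> X \<Longrightarrow>
      \<delta> \<cdot> pair E x y = yes \<cdot> bang E (Dom E y) \<longleftrightarrow> x = y"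
    using equality_test[OF P(1)] by blast
  let ?c = "\<delta> \<cdot> pair E (p X \<cdot> (a \<cdot> bang E (\<Pi> X))) (Idn E (\<Pi> X))"
  have c: "?c \<cdot> p X = yes \<cdot> bang E (Dom E (?c \<cdot> p X))"
  proof (rule constant_yes)
    fix x
    assume x: "x \<in> Arr E" "Dom E x = One E" "Cod E x = Dom E (?c \<cdot> p X)"
    then have x': "Cod E x = X"
      using \<delta>(1-3) P a X by simp
    have "p X \<cdot> a = p X \<cdot> x"
      using p_eq_iff[of a x X] ind[of x] a x x' by simp
    then show "(?c \<cdot> p X) \<cdot> x = yes"
      using \<delta>(1-3) \<delta>(4)[of "p X \<cdot> x" "p X \<cdot> x"] P a x x' X by simp
  qed (use \<delta>(1-3) P a X in simp_all)
  \<comment> \<open>Factorizations through \<open>p X\<close> are unique, so agreement after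
    \<open>p X\<close> already gives equality of the two tests on \<open>\<Pi> X\<close>.\<close>
  have "?c = yes \<cdot> bang E (\<Pi> X)"
  proof -
    have "\<exists>!g. g \<in> Hom E (\<Pi> X) Two \<and> g \<cdot> p X = yes \<cdot> bang E X"
      by (rule p_props(6)[OF X]) (use X in simp_all)
    moreover have "?c \<in> Hom E (\<Pi> X) Two \<and> ?c \<cdot> p X = yes \<cdot> bang E X"
      using c \<delta>(1-3) P a X by simp
    moreover have "yes \<cdot> bang E (\<Pi> X) \<in> Hom E (\<Pi> X) Two \<and> (yes \<cdot> bang E (\<Pi> X)) \<cdot> p X = yes \<cdot> bang E X"
      using P X by simp
    ultimately show ?thesis
      by blast
  qed
  then have "p X \<cdot> (a \<cdot> bang E (\<Pi> X)) = Idn E (\<Pi> X)"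
    using \<delta>(4)[of "p X \<cdot> (a \<cdot> bang E (\<Pi> X))" "Idn E (\<Pi> X)"] P a X by simp
  then have "isomorphic E (\<Pi> X) (One E)"
    unfolding isomorphic_def
    by (intro bexI[of _ "bang E (\<Pi> X)"] bexI[of _ "p X \<cdot> a"]) (use P a X in simp_all)
  then show ?thesis
    using X by (simp add: is_connected_def)
qed

section \<open>The four conditions\<close>

lemma Omega_connected_of_contractible:
  assumes "contractible E p (Omega E)"
  shows "indist (Tru E) (Fls E)"
proof -
  let ?\<Omega> = "Omega E"
  obtain a where a: "a \<in> Arr E" "Dom E a = One E" "Cod E a = ?\<Omega>"
    and hom: "homotopic E p (Idn E ?\<Omega>) (a \<cdot> bang E ?\<Omega>)"
    using assms by (auto simp: contractible_def point_def)
  have "p (Exp E ?\<Omega> ?\<Omega>) \<cdot> name_of E (Idn E ?\<Omega>) = p (Exp E ?\<Omega> ?\<Omega>) \<cdot> name_of E (a \<cdot> bang E ?\<Omega>)"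
    using hom by (simp add: homotopic_def)
  then have names: "indist (name_of E (Idn E ?\<Omega>)) (name_of E (a \<cdot> bang E ?\<Omega>))"
    using p_eq_iff[of "name_of E (Idn E ?\<Omega>)" "name_of E (a \<cdot> bang E ?\<Omega>)" "Exp E ?\<Omega> ?\<Omega>"] a by simp
  \<comment> \<open>Evaluation at \<omega> sends the name of the identity to \<omega> and the name
    of the constant arrow to a.\<close>
  have "indist \<omega> a" if \<omega>: "\<omega> \<in> Arr E" "Dom E \<omega> = One E" "Cod E \<omega> = ?\<Omega>" for \<omega>
    using indist_image[OF names, of "eval_at ?\<Omega> ?\<Omega> \<omega>"] eval_at(1-3)[OF \<omega>, of ?\<Omega>]
      eval_name[of "Idn E ?\<Omega>" \<omega>] eval_name[of "a \<cdot> bang E ?\<Omega>" \<omega>] \<omega> a by simp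
  from this[of "Tru E"] this[of "Fls E"] show ?thesis
    by (meson Tru_in_Arr Fls_in_Arr indist_trans indist_sym)
qed

lemma Omega_connected_of_bipointed:
  assumes "bipointed E A" "is_connected E \<Pi> A"
  shows "indist (Tru E) (Fls E)"
proof -
  obtain x y where x: "x \<in> Arr E" "Dom E x = One E" "Cod E x = A"
    and y: "y \<in> Arr E" "Dom E y = One E" "Cod E y = A" and neq: "x \<noteq> y"
    using assms(1) by (auto simp: bipointed_def point_def)
  have mx: "monic E x"
    using x by (simp add: monic_point)
  let ?\<chi> = "classifier E x"
  have "?\<chi> \<cdot> x = Tru E"
    using classifier_iff[OF mx, of x] factors_self[of x] x by (simp add: tru_One)
  \<comment> \<open>A point factoring through x would equal x, so this truth value is not true; NS
    leaves false as the only alternative.\<close>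
  moreover have "?\<chi> \<cdot> y = Fls E"
    using classifier_iff[OF mx, of y] factors_point[of x y] point_Omega[of "?\<chi> \<cdot> y"] x y neq mx
    by (auto simp: tru_One)
  moreover have "indist (?\<chi> \<cdot> x) (?\<chi> \<cdot> y)"
    using indist_image[OF connected_indist[OF assms(2), of x y], of ?\<chi>] x y mx by simp
  ultimately show ?thesis
    by simp
qed

lemma bipointed_Omega: "bipointed E (Omega E)"
  unfolding bipointed_def point_def using Tru_neq_Fls
  by (intro conjI exI[of _ "Tru E"] exI[of _ "Fls E"]) simp_all

section \<open>Consequences of non-separation of true and false\<close>

lemma connected_Omega:
  assumes "indist (Tru E) (Fls E)"
  shows "is_connected E \<Pi> (Omega E)"
proof (rule connectedI[of "Tru E"])
  fix x
  assume "x \<in> Arr E" "Dom E x = One E" "Cod E x = Omega E"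
  then show "indist (Tru E) x"
    using point_Omega[of x] assms indist_refl[of "Tru E"] by auto
qed simp_all

text \<open>A contraction acts pointwise on functions: for a point k of the exponential, K sends
  \<omega> to the function y \<mapsto> H (\<omega>, k y). Its value at true is k and at false the
  name c of the function constant at a, and arrows preserve non-separation.\<close>

lemma connected_Exp:
  assumes TF: "indist (Tru E) (Fls E)" and H: "contraction A a H" and Y: "Y \<in> Obj E"
  shows "is_connected E \<Pi> (Exp E A Y)"
proof -
  let ?\<Omega> = "Omega E"
  have H': "H \<in> Arr E" "Dom E H = Prod E ?\<Omega> A" "Cod E H = A"
    and a: "a \<in> Arr E" "Dom E a = One E" "Cod E a = A"
    and Hx: "\<And>x. x \<in> Arr E \<Longrightarrow> Cod E x = A \<Longrightarrow> H \<cdot> pair E (tru (Dom E x)) x = x"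
      "\<And>x. x \<in> Arr E \<Longrightarrow> Cod E x = A \<Longrightarrow> H \<cdot> pair E (fal (Dom E x)) x = a \<cdot> bang E (Dom E x)"
    using H by (simp_all add: contraction_def)
  have A: "A \<in> Obj E"
    using a by auto
  define c where "c = transpose E (One E) Y A (a \<cdot> bang E (Prod E (One E) Y))"
  have c: "c \<in> Arr E" "Dom E c = One E" "Cod E c = Exp E A Y"
    using a A Y by (simp_all add: c_def)
  have cb: "Ev E A Y \<cdot> pair E (c \<cdot> w) y = a \<cdot> bang E (Dom E y)"
    if "w \<in> Arr E" "y \<in> Arr E" "Dom E w = Dom E y" "Cod E w = One E" "Cod E y = Y" for w y
  proof -
    have "Ev E A Y \<cdot> pair E (c \<cdot> w) y = (a \<cdot> bang E (Prod E (One E) Y)) \<cdot> pair E w y"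
      unfolding c_def by (rule transpose_beta) (use that a Y in simp_all)
    then show ?thesis
      using that a Y by simp
  qed
  show ?thesis
  proof (rule connectedI[OF c])
    fix k
    assume k: "k \<in> Arr E" "Dom E k = One E" "Cod E k = Exp E A Y"
    let ?P1 = "Pr1 E ?\<Omega> Y" and ?P2 = "Pr2 E ?\<Omega> Y"
    define h where "h = H \<cdot> pair E ?P1 (Ev E A Y \<cdot> pair E (k \<cdot> bang E (Prod E ?\<Omega> Y)) ?P2)"
    define K where "K = transpose E ?\<Omega> Y A h"
    have h: "h \<in> Arr E" "Dom E h = Prod E ?\<Omega> Y" "Cod E h = A"
      using k H' A Y by (simp_all add: h_def)
    then have K: "K \<in> Arr E" "Dom E K = ?\<Omega>" "Cod E K = Exp E A Y"
      using Y by (simp_all add: K_def)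
    have Kb: "Ev E A Y \<cdot> pair E (K \<cdot> u) y = H \<cdot> pair E u (Ev E A Y \<cdot> pair E (k \<cdot> bang E (Dom E y)) y)"
      if "u \<in> Arr E" "y \<in> Arr E" "Dom E u = Dom E y" "Cod E u = ?\<Omega>" "Cod E y = Y" for u y
    proof -
      have "Ev E A Y \<cdot> pair E (K \<cdot> u) y = h \<cdot> pair E u y"
        unfolding K_def by (rule transpose_beta) (use that h Y in simp_all)
      then show ?thesis
        using that k H' A Y by (simp add: h_def)
    qed
    have bang: "w = bang E (Dom E w)" if "w \<in> Arr E" "Cod E w = One E" for w
      by (rule Arr_One_unique) (use that in simp_all)
    have "K \<cdot> Tru E = k"
    proof (rule Exp_ext[where Y = A and X = Y])
      fix w y
      assume "w \<in> Arr E" "y \<in> Arr E" "Dom E w = Dom E y" "Cod E w = Dom E k" "Cod E y = Y"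
      then have y: "y \<in> Arr E" "Cod E y = Y" and w: "w = bang E (Dom E y)"
        using bang[of w] k by auto
      show "Ev E A Y \<cdot> pair E ((K \<cdot> Tru E) \<cdot> w) y = Ev E A Y \<cdot> pair E (k \<cdot> w) y"
        unfolding w using Kb[of "tru (Dom E y)" y] Hx(1)[of "Ev E A Y \<cdot> pair E (k \<cdot> bang E (Dom E y)) y"]
          K k y A Y by (simp add: tru_def)
    qed (use K k Y A in simp_all)
    moreover have "K \<cdot> Fls E = c"
    proof (rule Exp_ext[where Y = A and X = Y])
      fix w y
      assume "w \<in> Arr E" "y \<in> Arr E" "Dom E w = Dom E y" "Cod E w = Dom E c" "Cod E y = Y"
      then have y: "y \<in> Arr E" "Cod E y = Y" and w: "w = bang E (Dom E y)"
        using bang[of w] c by auto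
      show "Ev E A Y \<cdot> pair E ((K \<cdot> Fls E) \<cdot> w) y = Ev E A Y \<cdot> pair E (c \<cdot> w) y"
        unfolding w using Kb[of "fal (Dom E y)" y] Hx(2)[of "Ev E A Y \<cdot> pair E (k \<cdot> bang E (Dom E y)) y"]
          cb[of "bang E (Dom E y)" y] K k y A Y c by (simp add: fal_def)
    qed (use K c Y A in simp_all)
    ultimately show "indist c k"
      using indist_image[OF indist_sym[OF TF], of K] K by simp
  qed
qed

text \<open>Conjunction makes the exponential of \<open>Omega E\<close> by itself connected, so the
  names of the identity and of the constant false cannot be separated.\<close>

lemma contractible_Omega:
  assumes "indist (Tru E) (Fls E)"
  shows "contractible E p (Omega E)"
proof -
  let ?\<Omega> = "Omega E"
  have "is_connected E \<Pi> (Exp E ?\<Omega> ?\<Omega>)"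
    by (rule connected_Exp[OF assms contraction_Omega]) simp
  then have "indist (name_of E (Idn E ?\<Omega>)) (name_of E (Fls E \<cdot> bang E ?\<Omega>))"
    by (rule connected_indist) simp_all
  then have "homotopic E p (Idn E ?\<Omega>) (Fls E \<cdot> bang E ?\<Omega>)"
    using p_eq_iff[of "name_of E (Idn E ?\<Omega>)" "name_of E (Fls E \<cdot> bang E ?\<Omega>)" "Exp E ?\<Omega> ?\<Omega>"]
    by (simp add: homotopic_def)
  then show ?thesis
    unfolding contractible_def point_def by (intro conjI exI[of _ "Fls E"]) simp_all
qed

lemma sufficiently_cohesive_of_Omega:
  assumes "indist (Tru E) (Fls E)"
  shows "sufficiently_cohesive E \<Pi>"
  unfolding sufficiently_cohesive_def
proof
  fix X
  assume X: "X \<in> Obj E"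
  obtain a H where "contraction (Exp E (Omega E) X) a H"
    using contraction_power[OF X] by blast
  then have "Lawvere_contractible E \<Pi> (Exp E (Omega E) X)"
    using connected_Exp[OF assms] X by (simp add: Lawvere_contractible_def)
  moreover have "subobject E (Exp E (Omega E) X) (sing X)" "Dom E (sing X) = X"
    using monic_sing[OF X] X by (simp_all add: subobject_def)
  ultimately show "\<exists>A m. Lawvere_contractible E \<Pi> A \<and> subobject E A m \<and> Dom E m = X"
    by blast
qed

text \<open>Take the exponent 1. Evaluation at the only point of 1 sends the name of a point back to
  that point, so no isomorphism between A and its first power is needed.\<close>

lemma Lawvere_contractible_connected:
  assumes L: "Lawvere_contractible E \<Pi> A" and a: "a \<in> Arr E" "Dom E a = One E" "Cod E a = A"
  shows "is_connected E \<Pi> A"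
proof (rule connectedI[OF a])
  have A: "A \<in> Obj E"
    using a by auto
  have conn: "is_connected E \<Pi> (Exp E A (One E))"
    using L by (simp add: Lawvere_contractible_def)
  fix x
  assume x: "x \<in> Arr E" "Dom E x = One E" "Cod E x = A"
  have "indist (name_of E a) (name_of E x)"
    by (rule connected_indist[OF conn]) (use a x in simp_all)
  then show "indist a x"
    using indist_image[of "name_of E a" "name_of E x" "eval_at A (One E) (Idn E (One E))"]
      eval_at(1-3)[of "Idn E (One E)" "One E" A]
      eval_name[of a "Idn E (One E)"] eval_name[of x "Idn E (One E)"] a x A by simp
qed

text \<open>Embed \<open>Omega E\<close> into a Lawvere contractible object: a monic arrow keeps
  true and false distinct.\<close>

lemma bipointed_of_sufficiently_cohesive:
  assumes "sufficiently_cohesive E \<Pi>"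
  shows "\<exists>A. bipointed E A \<and> is_connected E \<Pi> A"
proof -
  obtain A m where A: "Lawvere_contractible E \<Pi> A" "monic E m" "Cod E m = A" "Dom E m = Omega E"
    using assms Omega_Obj unfolding sufficiently_cohesive_def subobject_def by blast
  have "m \<cdot> Tru E \<noteq> m \<cdot> Fls E"
    using monicD[OF A(2), of "Tru E" "Fls E"] Tru_neq_Fls A by auto
  then have "bipointed E A"
    unfolding bipointed_def point_def using A
    by (intro conjI exI[of _ "m \<cdot> Tru E"] exI[of _ "m \<cdot> Fls E"]) auto
  moreover have "is_connected E \<Pi> A"
    by (rule Lawvere_contractible_connected[OF A(1), of "m \<cdot> Tru E"]) (use A in simp_all)
  ultimately show ?thesis
    by blast
qed

text \<open>A non-initial stage refuting membership in \<open>incl\<close> would have a point by NS,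
  yielding a point of \<open>Omega E\<close> outside \<open>incl\<close>, which contains all of
  them.\<close>

lemma dense_incl: "dense E (dneg E) incl"
proof -
  let ?\<kappa> = "classifier E incl"
  have \<kappa>: "?\<kappa> \<in> Arr E" "Dom E ?\<kappa> = Omega E" "Cod E ?\<kappa> = Omega E"
    using monic_incl by simp_all
  have "neg E \<cdot> (neg E \<cdot> ?\<kappa>) = tru (Omega E)"
  proof (rule neg_forcesI)
    fix v
    assume v: "v \<in> Arr E" "Cod E v = Omega E" "(neg E \<cdot> ?\<kappa>) \<cdot> v = tru (Dom E v)"
    show "initial E (Dom E v)"
    proof (rule ccontr)
      assume "\<not> initial E (Dom E v)"
      then obtain x where x: "x \<in> Arr E" "Dom E x = One E" "Cod E x = Dom E v"
        using point_ex[of "Dom E v"] v by auto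
      have "?\<kappa> \<cdot> (v \<cdot> x) = Tru E"
        using classifier_iff[OF monic_incl, of "v \<cdot> x"] factors_incl[of "v \<cdot> x"] v x by (simp add: tru_One)
      moreover have "neg E \<cdot> (?\<kappa> \<cdot> (v \<cdot> x)) = Tru E"
        using comp_reassoc[OF v(3), of x] v x \<kappa> by (simp add: tru_One)
      ultimately show False
        using neg_Tru Tru_neq_Fls by simp
    qed
  qed (use \<kappa> in simp_all)
  then show ?thesis
    using monic_incl by (simp add: dense_iff)
qed

lemma sheaf_connected:
  assumes TF: "indist (Tru E) (Fls E)" and F: "sheaf E (dneg E) F" "\<not> initial E F"
  shows "is_connected E \<Pi> F"
proof -
  have "F \<in> Obj E"
    using F(1) by (simp add: sheaf_def)
  then obtain a where a: "a \<in> Arr E" "Dom E a = One E" "Cod E a = F"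
    using point_ex F(2) by blast
  show ?thesis
  proof (rule connectedI[OF a])
    fix x
    assume x: "x \<in> Arr E" "Dom E x = One E" "Cod E x = F"
    obtain h where h: "h \<in> Arr E" "Dom E h = Two" "Cod E h = F" "h \<cdot> yes = a" "h \<cdot> no = x"
      using Two_copair[OF a x] by blast
    \<comment> \<open>The sheaf condition for the dense \<open>incl\<close> extends h, which
      prescribes a and x as values on 1 + 1, to all truth values.\<close>
    have "\<exists>!g. g \<in> Hom E (Cod E incl) F \<and> g \<cdot> incl = h"
    proof -
      have "h \<in> Hom E (Dom E incl) F"
        using h(1-3) by simp
      then show ?thesis
        using F(1) dense_incl unfolding sheaf_def by blast
    qed
    then obtain g where g: "g \<in> Arr E" "Dom E g = Omega E" "Cod E g = F" "g \<cdot> incl = h"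
      by auto
    have "g \<cdot> Tru E = a" "g \<cdot> Fls E = x"
      using comp_reassoc[OF g(4), of yes] comp_reassoc[OF g(4), of no] g(1-3) h by simp_all
    then show "indist a x"
      using indist_image[OF TF, of g] g by simp
  qed
qed

lemma bipointed_of_sheaves:
  assumes "\<And>F. sheaf E (dneg E) F \<Longrightarrow> \<not> initial E F \<Longrightarrow> is_connected E \<Pi> F"
  shows "\<exists>A. bipointed E A \<and> is_connected E \<Pi> A"
proof -
  \<comment> \<open>Equalizing double negation with the identity cuts out the regular truth values;
    true and false are among them because negation exchanges the two.\<close>
  obtain e where e: "monic E e" "Cod E e = Omega E"
    "\<And>w. w \<in> Arr E \<Longrightarrow> Cod E w = Omega E \<Longrightarrow>
      factors_through E w e \<longleftrightarrow> (neg E \<cdot> neg E) \<cdot> w = Idn E (Omega E) \<cdot> w"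
    using equalizer_ex[of "neg E \<cdot> neg E" "Idn E (Omega E)"] by auto
  then have e_iff: "\<And>w. w \<in> Arr E \<Longrightarrow> Cod E w = Omega E \<Longrightarrow>
      factors_through E w e \<longleftrightarrow> neg E \<cdot> (neg E \<cdot> w) = w"
    by simp
  have "factors_through E (Tru E) e" "factors_through E (Fls E) e"
    by (simp_all add: e_iff neg_Tru neg_Fls)
  then obtain t f where t: "e \<cdot> t = Tru E" "t \<in> Arr E" "Dom E t = One E" "Cod E t = Dom E e"
    and f: "e \<cdot> f = Fls E" "f \<in> Arr E" "Dom E f = One E" "Cod E f = Dom E e"
    by (auto elim!: factorsE)
  have "bipointed E (Dom E e)"
    unfolding bipointed_def point_def using t f e(1) Tru_neq_Fls
    by (intro conjI exI[of _ t] exI[of _ f]) auto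
  moreover have "\<not> initial E (Dom E e)"
    using initial_strict[of "Dom E e" t] t nondegenerate by auto
  ultimately show ?thesis
    using assms sheaf_regular[OF e(1,2) e_iff] by blast
qed

end

text \<open>Nondegeneracy cannot be dropped: if 1 is initial, then by strictness every object is
  initial, so condition (4) is vacuous, while no object has two different points and (3)
  fails.\<close>

theorem theoremE:
  fixes E :: "('o, 'a) topos" and \<Pi> :: "'o \<Rightarrow> 'o" and p :: "'o \<Rightarrow> 'a"
  assumes "topos E"
    and nondegenerate: "\<not> initial E (One E)"
    and "NS E" and "WDQO E" and "DSO E"
    and "homotopy_theory E \<Pi> p"
  shows "(sufficiently_cohesive E \<Pi> \<longleftrightarrow> contractible E p (Omega E)) \<and>
    (contractible E p (Omega E) \<longleftrightarrow> (\<exists>A. bipointed E A \<and> is_connected E \<Pi> A)) \<and>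
    ((\<exists>A. bipointed E A \<and> is_connected E \<Pi> A) \<longleftrightarrow>
      (\<forall>F. sheaf E (dneg E) F \<and> \<not> initial E F \<longrightarrow> is_connected E \<Pi> F))"
proof -
  interpret topos E
    by (fact assms(1))
  interpret homotopy_topos E \<Pi> p
    by unfold_locales (fact assms)+
  have 1: "sufficiently_cohesive E \<Pi> \<longleftrightarrow> indist (Tru E) (Fls E)"
    using sufficiently_cohesive_of_Omega bipointed_of_sufficiently_cohesive
      Omega_connected_of_bipointed by blast
  have 2: "contractible E p (Omega E) \<longleftrightarrow> indist (Tru E) (Fls E)"
    using contractible_Omega Omega_connected_of_contractible by blast
  have 3: "(\<exists>A. bipointed E A \<and> is_connected E \<Pi> A) \<longleftrightarrow> indist (Tru E) (Fls E)"
    using connected_Omega bipointed_Omega Omega_connected_of_bipointed by blast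
  have 4: "(\<forall>F. sheaf E (dneg E) F \<and> \<not> initial E F \<longrightarrow> is_connected E \<Pi> F) \<longleftrightarrow>
      indist (Tru E) (Fls E)"
    using sheaf_connected bipointed_of_sheaves Omega_connected_of_bipointed by blast
  show ?thesis
    unfolding 1 2 3 4 by blast
qed

end
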